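(* Let $L_1=\{z\in\mathbb{H}:\operatorname{Re}z=-\tfrac12\}$, $L_2=\{z\in\mathbb{H}:|z|=1\}$, $L_3=\{z\in\mathbb{H}:\operatorname{Re}z=0\}$, and let $z_0\in\mathbb{H}$ with $-\tfrac12<\operatorname{Re}z_0<0$ and $|z_0|>1$. Let $s_1(z)=-1-\bar z$, $s_2(z)=1/\bar z$, $s_3(z)=-\bar z$ (the reflections in $L_1,L_2,L_3$), generating $W\cong PGL_2(\mathbb{Z})$, and let $(z_m)_{m\ge0}$ be the reduced random walk defined in the context. Then the limit $\zeta=\lim_{m\to\infty}z_m$ almost surely exists and is a real number, and its cumulative distribution function $F_\zeta(x)=\Pr[\zeta\le x]$ is, for all $x\in\mathbb{R}$, $$F_\zeta(x)=\begin{cases}\mathcal{I}(-1/x)& x\le-2,\\ \tfrac14-\tfrac12\mathcal{I}(-x-1)& -2\le x\le-1,\\ \tfrac14+\tfrac12\mathcal{I}(-1-1/x)+\tfrac12\mathcal{I}(x+1)& -1\le x\le-\tfrac12,\\ \tfrac12-\tfrac12\mathcal{I}(-x)& -\tfrac12\le x\le0,\\ \tfrac12+\mathcal{I}(x)& 0\le x\le1,\\ \tfrac78+\tfrac14\mathcal{I}(x-1)& 1\le x\le2,\\ 1-\tfrac12\mathcal{I}(1/x)& 2\le x.\end{cases}$$ In particular: (i) $F_\zeta$ is continuous and strictly increasing; (ii) $F_\zeta(x)$ is a dyadic rational for every $x\in\mathbb{Q}$; (iii) $F_\zeta(x)$ is rational for every quadratic irrational $x$.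
   Context: $\mathbb{H}=\{z\in\mathbb{C}:\operatorname{Im}z>0\}$, $\overline{\mathbb{R}}=\mathbb{R}\cup\{\infty\}$, $\overline{\mathbb{H}}=\mathbb{H}\cup\overline{\mathbb{R}}$. The one-way reflection $\tau_i\colon\overline{\mathbb{H}}\to\overline{\mathbb{H}}$ is $\tau_i(z)=s_i(z)$ if $z$ and $z_0$ are on the same side of $L_i$ and $\tau_i(z)=z$ otherwise. Let $i_1,i_2,\ldots$ be independent uniform random elements of $\{1,2,3\}$ and $z_m=(\tau_{i_1}\circ\cdots\circ\tau_{i_m})(z_0)$; equivalently $z_m=u_m(z_0)$ with $u_0=1$, $u_{m+1}=u_ms_{i_{m+1}}$ if $\ell(u_ms_{i_{m+1}})>\ell(u_m)$ and $u_{m+1}=u_m$ otherwise, $\ell$ being word length in $W$ with respect to $\{s_1,s_2,s_3\}$. For $x\in\mathbb{R}$ let $\{x\}=x-\lfloor x\rfloor$. The interrobang function $\mathcal{I}\colon[0,1]\cap\mathbb{Q}\to\mathbb{R}$ is defined recursively by $\mathcal{I}(0)=0$; $\mathcal{I}(x)=4^{-\lfloor1/x\rfloor}\big(1-2\,\mathcal{I}(\{1/x\})\big)$ if $0<x\le\tfrac12$; and $\mathcal{I}(x)=\tfrac38-\tfrac34\,\mathcal{I}(1/x-1)-\tfrac12\,\mathcal{I}(1-x)$ if $\tfrac12<x\le1$ (well founded by the height $a/b\mapsto|a|+|b|$). It is a fact (proved in the paper) that this function extends uniquely to a continuous strictly increasing function $\mathcal{I}\colon[0,1]\to\mathbb{R}$;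 $\mathcal{I}$ in the formula denotes this extension. A dyadic rational is a rational whose denominator in lowest terms is a power of $2$; a quadratic irrational is an irrational root of a nonzero rational quadratic polynomial. *)

theory Defs
  imports "HOL-Probability.Probability"
begin

text \<open>Reflections in L1 (Re z = -1/2), L2 (|z| = 1), L3 (Re z = 0).
  The walk starts at z0 in the upper half plane and the reflections preserve it,
  so we work on complex numbers (the point at infinity is never reached).\<close>

definition refl :: "nat \<Rightarrow> complex \<Rightarrow> complex" where
  "refl i z = (if i = 1 then -1 - cnj z
               else if i = 2 then 1 / cnj z
               else if i = 3 then - cnj z else z)"

definition side :: "nat \<Rightarrow> complex \<Rightarrow> real" where
  "side i z = (if i = 1 then Re z + 1/2
               else if i = 2 then cmod z - 1
               else Re z)"

definition same_side :: "complex \<Rightarrow> nat \<Rightarrow> complex \<Rightarrow> bool" where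
  "same_side z0 i z \<longleftrightarrow> side i z * side i z0 > 0"

definition tau :: "complex \<Rightarrow> nat \<Rightarrow> complex \<Rightarrow> complex" where
  "tau z0 i z = (if same_side z0 i z then refl i z else z)"

text \<open>walkmap z0 \<omega> m = tau_{i_1} o ... o tau_{i_m}, where i_{k+1} = \<omega> k.\<close>
primrec walkmap :: "complex \<Rightarrow> (nat \<Rightarrow> nat) \<Rightarrow> nat \<Rightarrow> complex \<Rightarrow> complex" where
  "walkmap z0 \<omega> 0 = id"
| "walkmap z0 \<omega> (Suc m) = walkmap z0 \<omega> m \<circ> tau z0 (\<omega> m)"

definition walk :: "complex \<Rightarrow> (nat \<Rightarrow> nat) \<Rightarrow> nat \<Rightarrow> complex" where
  "walk z0 \<omega> m = walkmap z0 \<omega> m z0"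

definition walk_space :: "(nat \<Rightarrow> nat) measure" where
  "walk_space = (\<Pi>\<^sub>M k\<in>(UNIV::nat set). measure_pmf (pmf_of_set {1,2,3::nat}))"

definition zeta :: "complex \<Rightarrow> (nat \<Rightarrow> nat) \<Rightarrow> real" where
  "zeta z0 \<omega> = Re (lim (\<lambda>m. walk z0 \<omega> m))"

definition F_zeta :: "complex \<Rightarrow> real \<Rightarrow> real" where
  "F_zeta z0 x = measure walk_space {\<omega> \<in> space walk_space. zeta z0 \<omega> \<le> x}"

definition interrobang_eqns :: "(real \<Rightarrow> real) \<Rightarrow> bool" where
  "interrobang_eqns f \<longleftrightarrow>
     f 0 = 0 \<and>
     (\<forall>x\<in>\<rat>. 0 < x \<and> x \<le> 1/2 \<longrightarrow>
        f x = 4 powr (- real_of_int \<lfloor>1/x\<rfloor>) * (1 - 2 * f (frac (1/x)))) \<and>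
     (\<forall>x\<in>\<rat>. 1/2 < x \<and> x \<le> 1 \<longrightarrow>
        f x = 3/8 - 3/4 * f (1/x - 1) - 1/2 * f (1 - x))"

definition interrobang_rat :: "real \<Rightarrow> real" where
  "interrobang_rat = (THE f. interrobang_eqns f \<and> (\<forall>x. x \<notin> \<rat> \<inter> {0..1} \<longrightarrow> f x = 0))"

definition interrobang :: "real \<Rightarrow> real" where
  "interrobang = (THE g. continuous_on {0..1} g \<and>
                        (\<forall>x\<in>\<rat> \<inter> {0..1}. g x = interrobang_rat x) \<and>
                        (\<forall>x. x \<notin> {0..1} \<longrightarrow> g x = 0))"

definition dyadic :: "real \<Rightarrow> bool" where
  "dyadic y \<longleftrightarrow> (\<exists>(a::int) (k::nat). y = of_int a / 2 ^ k)"

definition quadratic_irrational :: "real \<Rightarrow> bool" where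
  "quadratic_irrational x \<longleftrightarrow> x \<notin> \<rat> \<and>
     (\<exists>a b c :: rat. (a, b, c) \<noteq> (0, 0, 0) \<and> of_rat a * x^2 + of_rat b * x + of_rat c = 0)"

end

theory Submission
  imports Defs
begin

text \<open>The folds \<tau>_i are 1-Lipschitz for the Euclidean metric of the whole complex plane, and
  \<tau>_2 \<circ> (\<tau>_3 \<circ> \<tau>_1)^n maps the plane into a ball of radius O(1/n) around 0. Since this word
  almost surely occurs in the random sequence for every n, the walk almost surely converges, and its
  limit is real because the folds preserve the real line. Conditioning on the first step shows that the
  law of the limit is stationary under the three folds of the real line. Stationarity forces the
  law to have no atoms (the supremum S of the point masses satisfies S \<le> 13/16 S) and full
  support (the support contains 0 and is closed under the folds, which reach every
  rational number), and yields functional equations for the distribution function F.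
  By these equations, x \<mapsto> F x - 1/2 satisfies on [0,1] the recursion that characterises the
  interrobang function on the rationals, which gives the formula for F. With G the Gauss map, the
  recursion expresses I(x) through I(G x) and I(G (G x)) with rational coefficients
  whose absolute values sum to less than 1. On a quadratic irrational the orbit of G is eventually
  periodic, and the resulting linear system has a unique, hence rational, solution.\<close>

subsection \<open>Rational induction and dyadic numbers\<close>

text \<open>The cases are those of the interrobang recursion. For x = a/b the recursive arguments
  are (b mod a)/a, (b - a)/a and (b - a)/b; each has a smaller sum of numerator and denominator,
  even without reduction to lowest terms.\<close>

lemma unit_rat_induct [consumes 2, case_names zero low high]:
  fixes x :: real
  assumes "x \<in> \<rat>" "x \<in> {0..1}"
    and zero: "P 0"
    and low: "\<And>x. x \<in> \<rat> \<Longrightarrow> 0 < x \<Longrightarrow> x \<le> 1/2 \<Longrightarrow> P (frac (1/x)) \<Longrightarrow> P x"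
    and high: "\<And>x. x \<in> \<rat> \<Longrightarrow> 1/2 < x \<Longrightarrow> x \<le> 1 \<Longrightarrow> P (1/x - 1) \<Longrightarrow> P (1 - x) \<Longrightarrow> P x"
  shows "P x"
proof -
  have main: "P (real a / real b)" if "a \<le> b" "0 < b" for a b :: nat
    using that
  proof (induction "a + b" arbitrary: a b rule: less_induct)
    case less
    have rat: "real a / real b \<in> \<rat>" by simp
    consider "a = 0" | "0 < a" "2 * a \<le> b" | "b < 2 * a" by linarith
    then show ?case
    proof cases
      case 1
      then show ?thesis using zero by simp
    next
      case 2
      have "\<lfloor>real b / real a\<rfloor> = int (b div a)"
        by (rule floor_divide_of_nat_eq)
      moreover have "real b = real (b div a) * real a + real (b mod a)"
        by (metis div_mult_mod_eq of_nat_add of_nat_mult)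
      ultimately have "frac (1 / (real a / real b)) = real (b mod a) / real a"
        using 2 by (simp add: frac_def field_simps)
      moreover have "P (real (b mod a) / real a)"
      proof (rule less.hyps)
        have "b mod a < a" using 2 by simp
        then show "b mod a + a < a + b" "b mod a \<le> a" "0 < a" using 2 by linarith+
      qed
      ultimately show ?thesis
        using 2 low[OF rat] less.prems by simp
    next
      case 3
      have "P (real (b - a) / real a)" "P (real (b - a) / real b)"
        by (rule less.hyps; use 3 less.prems in linarith)+
      moreover have "1 / (real a / real b) - 1 = real (b - a) / real a"
        "1 - real a / real b = real (b - a) / real b"
        using 3 less.prems by (auto simp: field_simps of_nat_diff)
      ultimately show ?thesis
        using 3 high[OF rat] less.prems by (simp add: field_simps)
    qed
  qed
  obtain m n :: nat where "n \<noteq> 0" "\<bar>x\<bar> = real m / real n"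
    using \<open>x \<in> \<rat>\<close> by (rule Rats_abs_nat_div_natE)
  moreover from this \<open>x \<in> {0..1}\<close> have "x = real m / real n" by simp
  moreover from this \<open>n \<noteq> 0\<close> \<open>x \<in> {0..1}\<close> have "m \<le> n" by (simp add: divide_le_eq_1)
  ultimately show ?thesis using main[of m n] by simp
qed

lemma dyadic_of_int [simp]: "dyadic (of_int a)"
  unfolding dyadic_def by (intro exI[of _ a] exI[of _ 0]) simp

lemma dyadic_numeral [simp]: "dyadic 0" "dyadic 1" "dyadic (numeral n)"
  using dyadic_of_int[of 0] dyadic_of_int[of 1] dyadic_of_int[of "numeral n"] by simp_all

lemma dyadic_mult: "dyadic x \<Longrightarrow> dyadic y \<Longrightarrow> dyadic (x * y)"
  unfolding dyadic_def
proof (elim exE)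
  fix a b :: int and k l :: nat
  assume "x = of_int a / 2 ^ k" "y = of_int b / 2 ^ l"
  then show "\<exists>c m. x * y = real_of_int c / 2 ^ m"
    by (intro exI[of _ "a * b"] exI[of _ "k + l"]) (simp add: power_add)
qed

lemma dyadic_add: "dyadic x \<Longrightarrow> dyadic y \<Longrightarrow> dyadic (x + y)"
  unfolding dyadic_def
proof (elim exE)
  fix a b :: int and k l :: nat
  assume "x = of_int a / 2 ^ k" "y = of_int b / 2 ^ l"
  then show "\<exists>c m. x + y = real_of_int c / 2 ^ m"
    by (intro exI[of _ "a * 2 ^ l + b * 2 ^ k"] exI[of _ "k + l"])
      (simp add: power_add add_divide_distrib)
qed

lemma dyadic_diff: "dyadic x \<Longrightarrow> dyadic y \<Longrightarrow> dyadic (x - y)"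
  using dyadic_add[of x "- 1 * y"] dyadic_mult[of "-1" y] dyadic_of_int[of "-1"] by simp

lemma dyadic_divide_power2: "dyadic x \<Longrightarrow> dyadic (x / 2 ^ k)"
  unfolding dyadic_def
proof (elim exE)
  fix a :: int and l :: nat
  assume "x = of_int a / 2 ^ l"
  then show "\<exists>c m. x / 2 ^ k = real_of_int c / 2 ^ m"
    by (intro exI[of _ a] exI[of _ "l + k"]) (simp add: power_add)
qed

lemma dyadic_divide_numeral:
  assumes "dyadic x" shows "dyadic (x / 2)" "dyadic (x / 4)" "dyadic (x / 8)"
  using dyadic_divide_power2[OF assms, of 1] dyadic_divide_power2[OF assms, of 2]
    dyadic_divide_power2[OF assms, of 3] by simp_all

lemma dyadic_power: "dyadic x \<Longrightarrow> dyadic (x ^ k)"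
  by (induction k) (auto intro: dyadic_mult)

lemmas dyadic_intros = dyadic_add dyadic_diff dyadic_mult dyadic_divide_numeral dyadic_power

subsection \<open>The Gauss map on quadratic irrationals\<close>

definition gauss :: "real \<Rightarrow> real" where
  "gauss x = frac (1 / x)"

text \<open>Integer coefficients leave only finitely many forms with a c < 0 of a given
  discriminant; \<open>a \<noteq> 0\<close> keeps the root set of each form finite.\<close>

definition quad_root :: "int \<Rightarrow> int \<Rightarrow> int \<Rightarrow> real \<Rightarrow> bool" where
  "quad_root a b c x \<longleftrightarrow> a \<noteq> 0 \<and> of_int a * x\<^sup>2 + of_int b * x + of_int c = 0"

lemma gauss_irrational:
  assumes "x \<notin> \<rat>" shows "gauss x \<notin> \<rat>" "gauss x \<in> {0<..<1}"
proof -
  show "gauss x \<notin> \<rat>"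
  proof
    assume "gauss x \<in> \<rat>"
    then have "gauss x + of_int \<lfloor>1 / x\<rfloor> \<in> \<rat>" by (intro Rats_add) auto
    then have "1 / x \<in> \<rat>" by (simp add: gauss_def frac_def)
    with assms show False using Rats_divide[of 1 "1 / x"] by simp
  qed
  then have "gauss x \<noteq> 0" by auto
  then show "gauss x \<in> {0<..<1}"
    using frac_ge_0[of "1/x"] frac_lt_1[of "1/x"] by (auto simp: gauss_def)
qed

lemma gauss_iterate_irrational:
  assumes "x \<notin> \<rat>" "x \<in> {0<..<1}"
  shows "(gauss ^^ k) x \<notin> \<rat>" "(gauss ^^ k) x \<in> {0<..<1}"
  by (induction k) (use assms gauss_irrational in auto)

lemma quad_root_const_nonzero:
  assumes "x \<notin> \<rat>" "quad_root a b c x" shows "c \<noteq> 0"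
proof
  assume "c = 0"
  then have "x * (of_int a * x + of_int b) = 0"
    using assms(2) by (simp add: quad_root_def power2_eq_square algebra_simps)
  then consider "x = 0" | "of_int a * x + of_int b = 0" by auto
  then have "x = 0 \<or> x = - of_int b / of_int a"
    using assms(2) by cases (auto simp: quad_root_def field_simps add_eq_0_iff)
  with \<open>x \<notin> \<rat>\<close> show False by auto
qed

text \<open>Let r = 1/x and r' = a/(c r) be the roots of a + b t + c t^2. The new constant
  coefficient is c (n - r)(n - r'). The extra hypothesis gives a c <= c^2, hence r' <= 1/r < 1 <= n
  < r, so the new outer coefficients have opposite signs.\<close>

lemma quad_root_gauss:
  fixes a b c :: int
  assumes x: "x \<notin> \<rat>" "x \<in> {0<..<1}" and root: "quad_root a b c x"
  defines "n \<equiv> \<lfloor>1 / x\<rfloor>"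
  shows "quad_root c (b + 2 * c * n) (a + b * n + c * n\<^sup>2) (gauss x)"
    and "\<bar>a\<bar> \<le> \<bar>c\<bar> \<or> a * c < 0 \<Longrightarrow> c * (a + b * n + c * n\<^sup>2) < 0"
proof -
  have c: "c \<noteq> 0" using quad_root_const_nonzero[OF x(1) root] .
  define r where "r = 1 / x"
  have r: "r > 1" "x = 1 / r" using x by (auto simp: r_def field_simps)
  have eq: "of_int a + of_int b * r + of_int c * r\<^sup>2 = 0"
    using root r by (simp add: quad_root_def field_simps power2_eq_square)
  have g: "gauss x = r - of_int n" by (simp add: gauss_def frac_def r_def n_def)
  show "quad_root c (b + 2 * c * n) (a + b * n + c * n\<^sup>2) (gauss x)"
    using c eq unfolding quad_root_def g by (simp add: power2_eq_square algebra_simps)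
  have n1: "n \<ge> 1" using r unfolding n_def r_def[symmetric] by (simp add: le_floor_iff)
  have nr: "of_int n < r" using gauss_irrational(2)[OF x(1)] g by simp
  assume ac: "\<bar>a\<bar> \<le> \<bar>c\<bar> \<or> a * c < 0"
  have le: "real_of_int (a * c) \<le> real_of_int (c\<^sup>2)"
  proof -
    have "a * c \<le> c\<^sup>2"
      using ac
    proof
      assume "\<bar>a\<bar> \<le> \<bar>c\<bar>"
      then have "\<bar>a * c\<bar> \<le> \<bar>c\<bar> * \<bar>c\<bar>" unfolding abs_mult by (rule mult_right_mono) simp
      then show ?thesis by (simp add: power2_eq_square)
    next
      assume "a * c < 0"
      then show ?thesis using zero_le_power2[of c] by linarith
    qed
    then show ?thesis by (simp only: of_int_le_iff)
  qed
  have c2: "real_of_int (c\<^sup>2) > 0" using c by simp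
  have "real_of_int (a * c) < real_of_int (c\<^sup>2) * (of_int n * r)"
  proof -
    have "1 < of_int n * r"
      using n1 r mult_mono[of 1 "real_of_int n" r r] by linarith
    then have "real_of_int (c\<^sup>2) * 1 < real_of_int (c\<^sup>2) * (of_int n * r)"
      using c2 by (intro mult_strict_left_mono) auto
    with le show ?thesis by linarith
  qed
  \<comment> \<open>This product is c^2 r (n - r)(n - r'), written without division.\<close>
  then have "(of_int n - r) * (real_of_int (c\<^sup>2) * (of_int n * r) - real_of_int (a * c)) < 0"
    using nr by (intro mult_neg_pos) auto
  also have "(of_int n - r) * (real_of_int (c\<^sup>2) * (of_int n * r) - real_of_int (a * c)) =
      of_int (c * (a + b * n + c * n\<^sup>2)) * r"
  proof -
    have b: "of_int b * r = - of_int a - of_int c * r\<^sup>2" using eq by linarith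
    have "of_int (c * (a + b * n + c * n\<^sup>2)) * r =
        of_int c * (of_int a * r + of_int n * (of_int b * r) + of_int c * of_int n ^ 2 * r)"
      by (simp add: algebra_simps)
    then show ?thesis unfolding b by (simp add: power2_eq_square algebra_simps)
  qed
  finally have "real_of_int (c * (a + b * n + c * n\<^sup>2)) < 0"
    using r by (simp add: mult_less_0_iff)
  then show "c * (a + b * n + c * n\<^sup>2) < 0" by linarith
qed

text \<open>Lagrange's theorem. Substituting X = 1 / (n + Y) turns (a, b, c) into a form with leading
  coefficient c, so as long as no form with roots of opposite signs has been reached, the leading
  coefficient decreases in absolute value.\<close>

lemma quad_root_eventually_indefinite:
  assumes "x \<notin> \<rat>" "x \<in> {0<..<1}" "quad_root a b c x"
  shows "\<exists>k a' b' c'. quad_root a' b' c' ((gauss ^^ k) x) \<and> a' * c' < 0"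
  using assms
proof (induction "nat \<bar>a\<bar>" arbitrary: a b c x rule: less_induct)
  case less
  note step = quad_root_gauss[OF less.prems]
  show ?case
  proof (cases "\<bar>a\<bar> \<le> \<bar>c\<bar>")
    case True
    then have "quad_root c (b + 2 * c * \<lfloor>1 / x\<rfloor>) (a + b * \<lfloor>1 / x\<rfloor> + c * \<lfloor>1 / x\<rfloor>\<^sup>2) ((gauss ^^ 1) x)"
      "c * (a + b * \<lfloor>1 / x\<rfloor> + c * \<lfloor>1 / x\<rfloor>\<^sup>2) < 0"
      using step by auto
    then show ?thesis by blast
  next
    case False
    then have "nat \<bar>c\<bar> < nat \<bar>a\<bar>" by simp
    from less.hyps[OF this gauss_irrational[OF less.prems(1)] step(1)]
    obtain k a' b' c' where "quad_root a' b' c' ((gauss ^^ k) (gauss x))" "a' * c' < 0" by blast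
    then show ?thesis by (intro exI[of _ "Suc k"]) (auto simp: funpow_swap1)
  qed
qed

text \<open>If a c < 0, then D = b^2 + 4 |a c|, which bounds |a|, |b| and |c|.\<close>

lemma finite_indefinite_roots:
  fixes D :: int
  shows "finite {y. \<exists>a b c. quad_root a b c y \<and> a * c < 0 \<and> b\<^sup>2 - 4 * a * c = D}"
proof -
  let ?T = "{-D..D} \<times> {-D..D} \<times> {-D..D}"
  have fin: "finite {y. quad_root a b c y}" for a b c
  proof (cases "a = 0")
    case False
    then have "{y. quad_root a b c y} \<subseteq> {y. poly [:of_int c, of_int b, of_int a:] y = (0::real)}"
      by (auto simp: quad_root_def power2_eq_square algebra_simps)
    moreover have "finite {y. poly [:of_int c, of_int b, of_int a:] y = (0::real)}"
      using False by (intro poly_roots_finite) auto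
    ultimately show ?thesis by (rule finite_subset)
  qed (simp add: quad_root_def)
  have "(a, b, c) \<in> ?T" if "a * c < 0" "b\<^sup>2 - 4 * a * c = D" for a b c :: int
  proof -
    have "\<bar>a\<bar> * \<bar>c\<bar> = - (a * c)" using that(1) by (simp add: abs_mult[symmetric])
    moreover have "a \<noteq> 0" "c \<noteq> 0" using that(1) by auto
    then have "\<bar>a\<bar> \<le> \<bar>a\<bar> * \<bar>c\<bar>" "\<bar>c\<bar> \<le> \<bar>a\<bar> * \<bar>c\<bar>"
      by (simp_all add: mult_le_cancel_left1 mult_le_cancel_right1)
    moreover have "\<bar>b\<bar> \<le> b\<^sup>2"
    proof (cases "b = 0")
      case False
      then have "\<bar>b\<bar> * 1 \<le> \<bar>b\<bar> * \<bar>b\<bar>" by (intro mult_left_mono) auto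
      then show ?thesis by (simp add: power2_eq_square)
    qed simp
    ultimately show ?thesis using that(2) zero_le_power2[of b] by auto
  qed
  then have "{y. \<exists>a b c. quad_root a b c y \<and> a * c < 0 \<and> b\<^sup>2 - 4 * a * c = D}
      \<subseteq> (\<Union>(a, b, c) \<in> ?T. {y. quad_root a b c y})" by fastforce
  then show ?thesis by (rule finite_subset) (auto intro!: fin finite_UN_I)
qed

text \<open>The Gauss step preserves the discriminant and, once reached, the condition a c < 0. From
  the index k on, the orbit therefore stays in a finite set.\<close>

lemma gauss_orbit_periodic:
  assumes "x \<notin> \<rat>" "x \<in> {0<..<1}" "quad_root a b c x"
  shows "\<exists>i j. i + 2 \<le> j \<and> (gauss ^^ i) x = (gauss ^^ j) x"
proof -
  from quad_root_eventually_indefinite[OF assms] obtain k a1 b1 c1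
    where k: "quad_root a1 b1 c1 ((gauss ^^ k) x)" "a1 * c1 < 0" by blast
  define D where "D = b1\<^sup>2 - 4 * a1 * c1"
  define R where "R = {y. \<exists>a b c. quad_root a b c y \<and> a * c < 0 \<and> b\<^sup>2 - 4 * a * c = D}"
  have inR: "(gauss ^^ (k + j)) x \<in> R" for j
  proof (induction j)
    case 0
    then show ?case using k unfolding R_def D_def by auto
  next
    case (Suc j)
    let ?y = "(gauss ^^ (k + j)) x"
    obtain a b c where q: "quad_root a b c ?y" "a * c < 0" "b\<^sup>2 - 4 * a * c = D"
      using Suc unfolding R_def by blast
    define n where "n = \<lfloor>1 / ?y\<rfloor>"
    have "quad_root c (b + 2 * c * n) (a + b * n + c * n\<^sup>2) (gauss ?y)"
      "c * (a + b * n + c * n\<^sup>2) < 0"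
      using quad_root_gauss[OF gauss_iterate_irrational[OF assms(1,2)] q(1)] q(2)
      unfolding n_def by auto
    moreover have "(b + 2 * c * n)\<^sup>2 - 4 * c * (a + b * n + c * n\<^sup>2) = D"
      using q(3) by (simp add: power2_eq_square algebra_simps)
    ultimately show ?case unfolding R_def by auto
  qed
  \<comment> \<open>Comparing only every second iterate makes the indices of a coincidence differ by
    at least two.\<close>
  have "\<not> inj (\<lambda>j. (gauss ^^ (k + 2 * j)) x)"
  proof
    assume "inj (\<lambda>j. (gauss ^^ (k + 2 * j)) x)"
    moreover have "finite (range (\<lambda>j. (gauss ^^ (k + 2 * j)) x))"
      using inR unfolding R_def
      by (intro finite_subset[OF _ finite_indefinite_roots[of D]]) auto
    ultimately show False using finite_imageD infinite_UNIV_nat by blast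
  qed
  then obtain i j where "i \<noteq> j" "(gauss ^^ (k + 2 * i)) x = (gauss ^^ (k + 2 * j)) x"
    by (auto simp: inj_def)
  then show ?thesis
  proof (induction i j rule: linorder_wlog)
    case (le i j)
    then show ?case by (intro exI[of _ "k + 2 * i"] exI[of _ "k + 2 * j"]) auto
  qed (metis (no_types))
qed

section \<open>Linear recurrences with contracting rational coefficients\<close>

lemma contracting_recurrence_expand:
  fixes v :: "nat \<Rightarrow> real"
  assumes rec: "\<And>k. \<exists>A\<in>\<rat>. \<exists>B\<in>\<rat>. \<exists>C\<in>\<rat>. \<bar>B\<bar> + \<bar>C\<bar> < 1 \<and> v k = A + B * v (k+1) + C * v (k+2)"
  shows "\<exists>A\<in>\<rat>. \<exists>B\<in>\<rat>. \<exists>C\<in>\<rat>. \<bar>B\<bar> + \<bar>C\<bar> < 1 \<and> v k = A + B * v (k+Suc d) + C * v (k+Suc d+1)"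
proof (induction d)
  case 0
  then show ?case using rec[of k] by simp
next
  case (Suc d)
  then obtain A B C where 1: "A \<in> \<rat>" "B \<in> \<rat>" "C \<in> \<rat>" "\<bar>B\<bar> + \<bar>C\<bar> < 1"
    "v k = A + B * v (k+Suc d) + C * v (k+Suc d+1)" by blast
  obtain A' B' C' where 2: "A' \<in> \<rat>" "B' \<in> \<rat>" "C' \<in> \<rat>" "\<bar>B'\<bar> + \<bar>C'\<bar> < 1"
    "v (k + Suc d) = A' + B' * v (k+Suc d+1) + C' * v (k+Suc d+2)" using rec[of "k + Suc d"] by blast
  \<comment> \<open>Only the nearer of the two terms is replaced by the recurrence; this does not
    increase the absolute sum of the coefficients.\<close>
  have "\<bar>B * B' + C\<bar> + \<bar>B * C'\<bar> \<le> \<bar>B\<bar> * (\<bar>B'\<bar> + \<bar>C'\<bar>) + \<bar>C\<bar>"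
    using abs_triangle_ineq[of "B * B'" C] by (simp add: abs_mult algebra_simps)
  also have "\<dots> \<le> \<bar>B\<bar> + \<bar>C\<bar>"
    using 2 by (simp add: mult_left_le)
  finally have "\<bar>B * B' + C\<bar> + \<bar>B * C'\<bar> < 1" using 1 by linarith
  moreover have "v k = (A + B * A') + (B * B' + C) * v (k + Suc (Suc d)) + (B * C') * v (k + Suc (Suc d) + 1)"
    using 1 2 by (simp add: algebra_simps)
  moreover have "A + B * A' \<in> \<rat>" "B * B' + C \<in> \<rat>" "B * C' \<in> \<rat>"
    using 1 2 by simp_all
  ultimately show ?case
    by (intro bexI[of _ "A + B * A'"] bexI[of _ "B * B' + C"] bexI[of _ "B * C'"] conjI)
qed

text \<open>By periodicity the pair of v i and v (i+1) is fixed by a rational affine map whose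
  matrix has rows of absolute sum below 1. The identity minus this matrix is invertible, and
  Cramer's rule gives rational values.\<close>

lemma contracting_recurrence_rational:
  fixes v :: "nat \<Rightarrow> real"
  assumes rec: "\<And>k. \<exists>A\<in>\<rat>. \<exists>B\<in>\<rat>. \<exists>C\<in>\<rat>. \<bar>B\<bar> + \<bar>C\<bar> < 1 \<and> v k = A + B * v (k+1) + C * v (k+2)"
    and per: "i + 2 \<le> j" "v i = v j" "v (i+1) = v (j+1)"
  shows "v 0 \<in> \<rat>"
proof -
  note expand = contracting_recurrence_expand[of v, OF rec]
  have "i + Suc (j - i - 1) = j" "i + 1 + Suc (j - i - 2) = j" using per(1) by auto
  with expand[of i "j - i - 1"] expand[of "i + 1" "j - i - 2"]
  obtain A B C A' B' C' where
    1: "A \<in> \<rat>" "B \<in> \<rat>" "C \<in> \<rat>" "\<bar>B\<bar> + \<bar>C\<bar> < 1" "v i = A + B * v j + C * v (j+1)" and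
    2: "A' \<in> \<rat>" "B' \<in> \<rat>" "C' \<in> \<rat>" "\<bar>B'\<bar> + \<bar>C'\<bar> < 1" "v (i+1) = A' + B' * v j + C' * v (j+1)"
    by metis
  \<comment> \<open>The determinant of the identity minus the matrix with rows B, C and B',
    C'.\<close>
  define d where "d = (1 - B) * (1 - C') - C * B'"
  have "\<bar>C * B'\<bar> < (1 - \<bar>B\<bar>) * (1 - \<bar>C'\<bar>)"
    unfolding abs_mult using 1 2 by (intro mult_strict_mono') auto
  moreover have "(1 - \<bar>B\<bar>) * (1 - \<bar>C'\<bar>) \<le> (1 - B) * (1 - C')"
    using 1 2 by (intro mult_mono) auto
  ultimately have d: "d > 0" unfolding d_def using abs_ge_self[of "C * B'"] by linarith
  have e1: "v i * (1 - B) = A + C * v (i+1)" "v (i+1) * (1 - C') = A' + B' * v i"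
    using 1(5) 2(5) per by (auto simp: algebra_simps)
  have "v i * d = (v i * (1 - B)) * (1 - C') - C * B' * v i"
    unfolding d_def by (simp add: algebra_simps)
  also have "\<dots> = A * (1 - C') + C * (v (i+1) * (1 - C')) - C * B' * v i"
    unfolding e1(1) by (simp add: algebra_simps)
  also have "\<dots> = A * (1 - C') + C * A'" unfolding e1(2) by (simp add: algebra_simps)
  finally have vi: "v i = (A * (1 - C') + C * A') / d" using d by (simp add: field_simps)
  have "v (i+1) * d = (v (i+1) * (1 - C')) * (1 - B) - C * B' * v (i+1)"
    unfolding d_def by (simp add: algebra_simps)
  also have "\<dots> = A' * (1 - B) + B' * (v i * (1 - B)) - C * B' * v (i+1)"
    unfolding e1(2) by (simp add: algebra_simps)
  also have "\<dots> = A' * (1 - B) + B' * A" unfolding e1(1) by (simp add: algebra_simps)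
  finally have vi1: "v (i+1) = (A' * (1 - B) + B' * A) / d" using d by (simp add: field_simps)
  have "d \<in> \<rat>" unfolding d_def using 1 2 by auto
  then have rat: "v i \<in> \<rat>" "v (i+1) \<in> \<rat>" unfolding vi vi1 using 1 2 by auto
  show ?thesis
  proof (cases i)
    case 0
    with rat show ?thesis by simp
  next
    case (Suc d)
    from expand[of 0 d] rat show ?thesis unfolding Suc by auto
  qed
qed

section \<open>Quadratic irrationals under negation, translation and inversion\<close>

lemma quadratic_irrational_uminus: "quadratic_irrational x \<Longrightarrow> quadratic_irrational (- x)"
  unfolding quadratic_irrational_def
proof (elim conjE exE, intro conjI)
  fix a b c :: rat
  assume "(a, b, c) \<noteq> (0, 0, 0)" "of_rat a * x\<^sup>2 + of_rat b * x + of_rat c = 0"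
  then show "\<exists>a b c. (a, b, c) \<noteq> (0, 0, 0) \<and> of_rat a * (- x)\<^sup>2 + of_rat b * (- x) + of_rat c = 0"
    by (intro exI[of _ a] exI[of _ "- b"] exI[of _ c]) (auto simp: of_rat_minus)
qed simp

lemma quadratic_irrational_add_1: "quadratic_irrational x \<Longrightarrow> quadratic_irrational (x + 1)"
  unfolding quadratic_irrational_def
proof (elim conjE exE, intro conjI)
  fix a b c :: rat
  assume "(a, b, c) \<noteq> (0, 0, 0)" "of_rat a * x\<^sup>2 + of_rat b * x + of_rat c = 0"
  then show "\<exists>a b c. (a, b, c) \<noteq> (0, 0, 0) \<and> of_rat a * (x + 1)\<^sup>2 + of_rat b * (x + 1) + of_rat c = 0"
    by (intro exI[of _ a] exI[of _ "b - 2 * a"] exI[of _ "a - b + c"])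
      (auto simp: of_rat_add of_rat_diff of_rat_mult power2_eq_square algebra_simps)
next
  assume "x \<notin> \<rat>"
  then show "x + 1 \<notin> \<rat>" using Rats_diff[of "x + 1" 1] by auto
qed

lemma quadratic_irrational_inverse: "quadratic_irrational x \<Longrightarrow> quadratic_irrational (1 / x)"
  unfolding quadratic_irrational_def
proof (elim conjE exE, intro conjI)
  fix a b c :: rat
  assume "x \<notin> \<rat>" "(a, b, c) \<noteq> (0, 0, 0)" "of_rat a * x\<^sup>2 + of_rat b * x + of_rat c = 0"
  moreover from this have "x \<noteq> 0" by auto
  ultimately show "\<exists>a b c. (a, b, c) \<noteq> (0, 0, 0) \<and> of_rat a * (1 / x)\<^sup>2 + of_rat b * (1 / x) + of_rat c = 0"
    by (intro exI[of _ c] exI[of _ b] exI[of _ a]) (auto simp: power2_eq_square field_simps)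
next
  assume "x \<notin> \<rat>"
  then show "1 / x \<notin> \<rat>" using Rats_divide[of 1 "1 / x"] by auto
qed

lemma quadratic_irrational_quad_root:
  assumes "quadratic_irrational x" shows "\<exists>a b c. quad_root a b c x"
proof -
  obtain a b c :: rat where abc: "(a, b, c) \<noteq> (0, 0, 0)"
    "of_rat a * x\<^sup>2 + of_rat b * x + of_rat c = 0" and x: "x \<notin> \<rat>"
    using assms unfolding quadratic_irrational_def by blast
  have a: "a \<noteq> 0"
  proof
    assume "a = 0"
    moreover from this abc have "b \<noteq> 0" by (cases "b = 0") auto
    ultimately have "x = - of_rat c / of_rat b" using abc(2) by (simp add: field_simps add_eq_0_iff)
    then have "x = of_rat (- c / b)" by (simp add: of_rat_minus of_rat_divide)
    with x show False by simp
  qed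
  obtain p1 q1 where 1: "q1 > 0" "a = of_int p1 / of_int q1" by (cases a) (auto simp: Fract_of_int_quotient)
  obtain p2 q2 where 2: "q2 > 0" "b = of_int p2 / of_int q2" by (cases b) (auto simp: Fract_of_int_quotient)
  obtain p3 q3 where 3: "q3 > 0" "c = of_int p3 / of_int q3" by (cases c) (auto simp: Fract_of_int_quotient)
  have "quad_root (p1 * q2 * q3) (p2 * q1 * q3) (p3 * q1 * q2) x"
    using abc(2) a 1 2 3 unfolding quad_root_def
    by (auto simp: of_rat_divide field_simps)
  then show ?thesis by blast
qed

subsection \<open>Measures stationary under the folds\<close>

text \<open>The action of \<open>tau z0 i\<close> on the real line (\<open>tau_of_real\<close>).
  Each fold keeps the side away from z0: x <= -1/2, |x| <= 1 and x >= 0 respectively.\<close>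

definition rfold :: "nat \<Rightarrow> real \<Rightarrow> real" where
  "rfold i x = (if i = 1 then min x (-1 - x)
                else if i = 2 then (if \<bar>x\<bar> > 1 then 1 / x else x)
                else if i = 3 then \<bar>x\<bar> else x)"

lemma rfold_simps:
  "rfold (Suc 0) x = min x (-1 - x)"
  "rfold 2 x = (if \<bar>x\<bar> > 1 then 1 / x else x)"
  "rfold 3 x = \<bar>x\<bar>"
  by (simp_all add: rfold_def)

lemma rfold_measurable [measurable]: "rfold i \<in> borel_measurable borel"
  unfolding rfold_def by measurable

lemma rfold_vimage_borel [simp]: "B \<in> sets borel \<Longrightarrow> rfold i -` B \<in> sets borel"
  using measurable_sets[OF rfold_measurable, of B i] by simp

lemma abs_rfold_2_le_1: "\<bar>rfold 2 x\<bar> \<le> 1"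
  by (auto simp: rfold_simps divide_le_eq_1)

text \<open>Stationarity is all that the study of the limit law takes from the walk;
  \<open>fold_stationary_zeta\<close> supplies it.\<close>

locale fold_stationary = real_distribution \<nu> for \<nu> +
  assumes stationary: "B \<in> sets borel \<Longrightarrow>
    3 * measure \<nu> B = measure \<nu> (rfold 1 -` B) + measure \<nu> (rfold 2 -` B) + measure \<nu> (rfold 3 -` B)"
begin

abbreviation F :: "real \<Rightarrow> real" where "F \<equiv> cdf \<nu>"

section \<open>Absence of point masses\<close>

lemma atom_bound:
  "3 * measure \<nu> {x} \<le> (if x \<le> -1/2 then measure \<nu> {x, -1 - x} else 0)
    + (if \<bar>x\<bar> \<le> 1 then measure \<nu> {x, 1/x} else 0) + (if 0 \<le> x then measure \<nu> {x, -x} else 0)"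
proof -
  have "measure \<nu> (rfold 1 -` {x}) \<le> measure \<nu> (if x \<le> -1/2 then {x, -1 - x} else {})"
    by (intro finite_measure_mono) (auto simp: rfold_simps min_def split: if_splits)
  moreover have "measure \<nu> (rfold 2 -` {x}) \<le> measure \<nu> (if \<bar>x\<bar> \<le> 1 then {x, 1/x} else {})"
    by (intro finite_measure_mono) (auto simp: rfold_simps split: if_splits)
  moreover have "measure \<nu> (rfold 3 -` {x}) \<le> measure \<nu> (if 0 \<le> x then {x, -x} else {})"
    by (intro finite_measure_mono) (auto simp: rfold_simps)
  moreover have "measure \<nu> (if P then A else {}) = (if P then measure \<nu> A else 0)" for P A
    by simp
  ultimately show ?thesis using stationary[of "{x}"] by simp
qed

lemma atom_pair: "measure \<nu> {x, y} \<le> measure \<nu> {x} + measure \<nu> {y}"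
  using measure_Un_le[of "{y}" \<nu> "{x}"] by simp

text \<open>\<open>atom_bound\<close> compares the mass of a point with the masses of its mirror
  images. From the bound B it yields in turn B/2 on x <= -1, B/4 on x >= 1, B/8 on x <= -2, B/16 on
  (-1/2, 0), then B/16 + B/2 = 9B/16 on (-1, -1/2), and finally B/4 + 9B/16 = 13B/16 on (0,
  1).\<close>

lemma atom_contraction:
  assumes B: "\<And>x. measure \<nu> {x} \<le> B"
  shows "measure \<nu> {x} \<le> 13/16 * B"
proof -
  let ?p = "\<lambda>x. measure \<nu> {x}"
  have B0: "B \<ge> 0" using B[of 0] measure_nonneg[of \<nu> "{0}"] by linarith
  \<comment> \<open>As 1/0 = 0, both pairs collapse to {0} and the bound reads 3 p(0) <= 2 p(0). At
    -1 and then at 1 the same happens up to a point already known to be null.\<close>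
  have p0: "?p 0 = 0"
    using atom_bound[of 0] by (intro antisym measure_nonneg) simp
  have pm1: "?p (-1) = 0"
    using atom_bound[of "-1"] p0 atom_pair[of "-1" 0] by (intro antisym measure_nonneg) simp
  have p1: "?p 1 = 0"
    using atom_bound[of 1] pm1 atom_pair[of 1 "-1"] by (intro antisym measure_nonneg) simp
  have r1: "2 * ?p x \<le> ?p (-1 - x)" if "x \<le> -1" for x
    using that atom_bound[of x] atom_pair[of x "-1 - x"] pm1 by (cases "x = -1") auto
  have r4: "2 * ?p x \<le> ?p (-x)" if "1 \<le> x" for x
    using that atom_bound[of x] atom_pair[of x "-x"] p1 by (cases "x = 1") auto
  have r3: "2 * ?p x \<le> ?p (1/x)" if "-1/2 < x" "x < 0" for x
    using that atom_bound[of x] atom_pair[of x "1/x"] by simp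
  have r2: "?p x \<le> ?p (-1 - x) + ?p (1/x)" if "-1 < x" "x < -1/2" for x
    using that atom_bound[of x] atom_pair[of x "1/x"] atom_pair[of x "-1-x"] by simp
  have r5: "?p x \<le> ?p (1/x) + ?p (-x)" if "0 < x" "x < 1" for x
    using that atom_bound[of x] atom_pair[of x "1/x"] atom_pair[of x "-x"] by simp
  have rh: "?p (-1/2) \<le> ?p (-2)"
    using atom_bound[of "-1/2"] atom_pair[of "-1/2" "-2"] by simp
  have b1: "?p x \<le> B/2" if "x \<le> -1" for x using r1[OF that] B[of "-1 - x"] by linarith
  have b4: "?p x \<le> B/4" if "x \<ge> 1" for x using r4[OF that] b1[of "-x"] that by simp
  have b1': "?p x \<le> B/8" if "x \<le> -2" for x using r1[of x] b4[of "-1-x"] that by simp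
  have b3: "?p x \<le> B/16" if "-1/2 < x" "x < 0" for x
    using r3[OF that] b1'[of "1/x"] that by (simp add: field_simps)
  have b2: "?p x \<le> 9/16 * B" if "x < 0" for x
  proof -
    consider "x \<le> -1" | "-1 < x" "x < -1/2" | "x = -1/2" | "-1/2 < x" by linarith
    then show ?thesis
    proof cases
      case 1
      then show ?thesis using b1[of x] B0 by simp
    next
      case 2
      then have "1/x \<le> -1" by (simp add: field_simps)
      then show ?thesis using r2[of x] b3[of "-1-x"] b1[of "1/x"] 2 by simp
    next
      case 3
      then show ?thesis using rh b1'[of "-2"] B0 by simp
    next
      case 4
      then show ?thesis using b3[of x] that B0 by simp
    qed
  qed
  consider "x < 0" | "x = 0" | "0 < x" "x < 1" | "1 \<le> x" by linarith
  then show ?thesis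
  proof cases
    case 3
    then have "1/x \<ge> 1" by (simp add: field_simps)
    then show ?thesis using r5[of x] b4[of "1/x"] b2[of "-x"] 3 by simp
  qed (use b2[of x] b4[of x] B0 p0 in auto)
qed

lemma no_atoms: "measure \<nu> {x} = 0"
proof -
  have "measure \<nu> {x} \<le> (13/16) ^ n" for x n
  proof (induction n arbitrary: x)
    case (Suc n)
    then show ?case using atom_contraction[of "(13/16) ^ n" x] by simp
  qed simp
  moreover have "(\<lambda>n. (13/16 :: real) ^ n) \<longlonglongrightarrow> 0"
    by (rule LIMSEQ_power_zero) simp
  ultimately have "measure \<nu> {x} \<le> 0"
    by (intro LIMSEQ_le_const) auto
  then show ?thesis using measure_nonneg[of \<nu> "{x}"] by linarith
qed

section \<open>Continuity, and the measures of preimages of half-lines\<close>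

lemma F_continuous: "continuous_on UNIV F"
  by (simp add: continuous_on_eq_continuous_at isCont_cdf no_atoms)

lemma measure_lessThan: "measure \<nu> {..<x} = F x"
proof -
  have "measure \<nu> {..x} = measure \<nu> {..<x} + measure \<nu> {x}"
    using finite_measure_Union[of "{..<x}" "{x}"] by (simp add: ivl_disj_un_singleton del: Un_insert_right)
  then show ?thesis by (simp add: no_atoms cdf_def)
qed

lemma measure_atLeast: "measure \<nu> {x..} = 1 - F x"
  using prob_compl[of "{..<x}"] by (simp add: measure_lessThan Compl_eq_Diff_UNIV[symmetric])

lemma measure_atLeastAtMost:
  assumes "x \<le> y" shows "measure \<nu> {x..y} = F y - F x"
proof -
  have "{..y} - {..<x} = {x..y}" by auto
  then show ?thesis
    using finite_measure_Diff[of "{..y}" "{..<x}"] assms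
    by (simp add: measure_lessThan cdf_def2 subset_iff)
qed

lemma measure_outside: "x \<le> y \<Longrightarrow> measure \<nu> ({..x} \<union> {y..}) = F x + 1 - F y"
proof -
  assume "x \<le> y"
  \<comment> \<open>For x = y the two half-lines share a point, which is a null set.\<close>
  have "measure \<nu> ({..x} \<union> {y..}) = measure \<nu> {..x} + measure \<nu> ({y..} - {x})"
    using \<open>x \<le> y\<close> by (subst finite_measure_Union[symmetric]) (auto intro!: arg_cong[of _ _ "measure \<nu>"])
  moreover have "measure \<nu> ({y..} - {x}) = measure \<nu> {y..}"
    by (intro measure_eq_AE) (auto intro!: AE_I[of _ _ "{x}"] simp: emeasure_eq_measure no_atoms)
  ultimately show ?thesis by (simp add: measure_atLeast cdf_def)
qed

lemma F_stationary:
  "3 * F x = measure \<nu> (rfold 1 -` {..x}) + measure \<nu> (rfold 2 -` {..x}) + measure \<nu> (rfold 3 -` {..x})"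
  using stationary[of "{..x}"] by (simp add: cdf_def)

lemma measure_UNIV: "measure \<nu> UNIV = 1"
  using prob_space by simp

lemma measure_rfold_1: "measure \<nu> (rfold 1 -` {..x}) = (if x < -1/2 then F x + 1 - F (-1-x) else 1)"
proof -
  have "rfold 1 -` {..x} = (if x < -1/2 then {..x} \<union> {-1-x..} else UNIV)"
    by (auto simp: rfold_simps min_def split: if_splits)
  then show ?thesis using measure_outside[of x "-1-x"] by (simp add: measure_UNIV)
qed

lemma measure_rfold_3: "measure \<nu> (rfold 3 -` {..x}) = (if x < 0 then 0 else F x - F (-x))"
proof -
  have "rfold 3 -` {..x} = (if x < 0 then {} else {-x..x})"
    by (auto simp: rfold_simps)
  then show ?thesis using measure_atLeastAtMost[of "-x" x] by simp
qed

text \<open>Inversion preserves signs, so the preimage of the half-line is in turn empty, [1/x, x],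
  the half-line itself, the half-line together with [1/x, \<infinity>), and everything. The point 0
  stands apart because the end 1/x should be infinite there, whereas the quotient 1/0 is 0.\<close>

lemma measure_rfold_2:
  "x < -1 \<Longrightarrow> measure \<nu> (rfold 2 -` {..x}) = 0"
  "-1 \<le> x \<Longrightarrow> x < 0 \<Longrightarrow> measure \<nu> (rfold 2 -` {..x}) = F x - F (1/x)"
  "measure \<nu> (rfold 2 -` {..0}) = F 0"
  "0 < x \<Longrightarrow> x \<le> 1 \<Longrightarrow> measure \<nu> (rfold 2 -` {..x}) = F x + 1 - F (1/x)"
  "1 \<le> x \<Longrightarrow> measure \<nu> (rfold 2 -` {..x}) = 1"
proof -
  have "rfold 2 -` {..x} = {}" if "x < -1"
  proof -
    have "\<not> rfold 2 y \<le> x" for y using abs_rfold_2_le_1[of y] that by linarith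
    then show ?thesis by auto
  qed
  then show "x < -1 \<Longrightarrow> measure \<nu> (rfold 2 -` {..x}) = 0" by simp
next
  assume x: "-1 \<le> x" "x < 0"
  have "rfold 2 y \<le> x \<longleftrightarrow> 1/x \<le> y \<and> y \<le> x" for y
  proof (cases "\<bar>y\<bar> > 1")
    case True
    then consider "y > 1" | "y < -1" by linarith
    then show ?thesis
    proof cases
      case 1
      then have "1/y > 0" by simp
      with 1 x have "\<not> 1/y \<le> x" "\<not> y \<le> x" by linarith+
      with 1 show ?thesis by (simp add: rfold_simps)
    qed (use x in \<open>auto simp: rfold_simps field_simps\<close>)
  next
    case False
    have "1/x \<le> -1" using x by (simp add: field_simps)
    with False show ?thesis by (auto simp: rfold_simps)
  qed
  then have "rfold 2 -` {..x} = {1/x..x}" by auto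
  moreover have "1/x \<le> x"
  proof -
    have "1/x \<le> -1" using x by (simp add: field_simps)
    then show ?thesis using x by linarith
  qed
  ultimately show "measure \<nu> (rfold 2 -` {..x}) = F x - F (1/x)"
    by (simp add: measure_atLeastAtMost)
next
  have "rfold 2 -` {..0} = {..0}"
    by (auto simp: rfold_simps divide_simps split: if_splits)
  then show "measure \<nu> (rfold 2 -` {..0}) = F 0" by (simp add: cdf_def)
next
  assume x: "0 < x" "x \<le> 1"
  have x1: "1/x \<ge> 1" using x by (simp add: field_simps)
  have "rfold 2 y \<le> x \<longleftrightarrow> y \<le> x \<or> 1/x \<le> y" if "y \<noteq> 1" for y
  proof (cases "\<bar>y\<bar> > 1")
    case True
    then consider "y > 1" | "y < -1" by linarith
    then show ?thesis
    proof cases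
      case 2
      then have "1/y < 0" by simp
      with 2 x have "1/y \<le> x" "y \<le> x" by linarith+
      with 2 show ?thesis by (simp add: rfold_simps)
    qed (use x in \<open>auto simp: rfold_simps field_simps\<close>)
  next
    case False
    with that x1 show ?thesis by (auto simp: rfold_simps)
  qed
  then have "measure \<nu> (rfold 2 -` {..x}) = measure \<nu> ({..x} \<union> {1/x..})"
    by (intro measure_eq_AE AE_I[of _ _ "{1}"])
      (auto simp: emeasure_eq_measure no_atoms)
  then show "measure \<nu> (rfold 2 -` {..x}) = F x + 1 - F (1/x)"
    using x x1 by (simp add: measure_outside)
next
  assume x: "1 \<le> x"
  have "rfold 2 -` {..x} = UNIV"
  proof -
    have "rfold 2 y \<le> x" for y using abs_rfold_2_le_1[of y] x by linarith
    then show ?thesis by auto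
  qed
  then show "measure \<nu> (rfold 2 -` {..x}) = 1" by (simp add: measure_UNIV)
qed

section \<open>Functional equations of the distribution function\<close>

lemma F_0: "F 0 = 1/2"
  using F_stationary[of 0] by (simp only: measure_rfold_1 measure_rfold_2 measure_rfold_3) simp

lemma F_minus_1: "F (-1) = 1/4"
  using F_stationary[of "-1"] F_0 by (simp only: measure_rfold_1 measure_rfold_3 measure_rfold_2(2)) simp

lemma F_le_minus_1: "x \<le> -1 \<Longrightarrow> 2 * F x = 1 - F (-1-x)"
  using F_stationary[of x] F_minus_1 F_0
  by (cases "x = -1") (simp_all only: measure_rfold_1 measure_rfold_3 measure_rfold_2(1), simp_all)

lemma F_minus_1_half: "-1 \<le> x \<Longrightarrow> x \<le> -1/2 \<Longrightarrow> F x = 1 - F (-1-x) - F (1/x)"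
  using F_stationary[of x]
  by (cases "x = -1/2") (simp_all only: measure_rfold_1 measure_rfold_3 measure_rfold_2(2), simp_all)

lemma F_half_0: "-1/2 \<le> x \<Longrightarrow> x < 0 \<Longrightarrow> 2 * F x = 1 - F (1/x)"
  using F_stationary[of x] by (simp only: measure_rfold_1 measure_rfold_3 measure_rfold_2(2)) simp

lemma F_0_1: "0 < x \<Longrightarrow> x \<le> 1 \<Longrightarrow> F x = 2 - F (1/x) - F (-x)"
  using F_stationary[of x] by (simp only: measure_rfold_1 measure_rfold_3 measure_rfold_2(4)) simp

lemma F_ge_1: "1 \<le> x \<Longrightarrow> 2 * F x = 2 - F (-x)"
  using F_stationary[of x] by (simp only: measure_rfold_1 measure_rfold_3 measure_rfold_2(5)) simp

text \<open>The shift by F 0 = 1/2 produces the initial value 0 of the interrobang recursion; on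
  [0, 1] the function J is the interrobang function (\<open>interrobang_eq\<close>).\<close>

definition J :: "real \<Rightarrow> real" where "J x = F x - 1/2"

lemma F_eq_J_0_1: "F x = 1/2 + J x"
  by (simp add: J_def)

lemma F_eq_J_m2_m1: "-2 \<le> x \<Longrightarrow> x \<le> -1 \<Longrightarrow> F x = 1/4 - 1/2 * J (-x-1)"
  using F_le_minus_1[of x] by (simp add: J_def minus_diff_commute diff_divide_distrib)

text \<open>\<open>F_half_0\<close> at 1/x and \<open>F_ge_1\<close> at -x express the right side of
  \<open>F_0_1\<close> at -1/x through F x alone; the outcome is F (-1/x) = 1/2 + F x.\<close>

lemma F_eq_J_le_m2:
  assumes "x \<le> -2" shows "F x = J (-1/x)"
proof -
  have 1: "-1/2 \<le> 1/x" "1/x < 0" using assms by (auto simp: field_simps)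
  show ?thesis
    using F_0_1[of "-1/x"] F_half_0[of "1/x"] F_ge_1[of "-x"] 1 assms by (simp add: J_def)
qed

lemma F_eq_J_mh_0:
  assumes "-1/2 \<le> x" "x \<le> 0" shows "F x = 1/2 - 1/2 * J (-x)"
proof (cases "x = 0")
  case False
  with assms have 1: "1/x \<le> -2" by (simp add: field_simps)
  then show ?thesis using F_half_0[of x] F_eq_J_le_m2[of "1/x"] assms False by simp
qed (simp add: J_def F_0)

lemma F_eq_J_m1_mh:
  assumes "-1 \<le> x" "x \<le> -1/2" shows "F x = 1/4 + 1/2 * J (-1 - 1/x) + 1/2 * J (x+1)"
proof -
  have "-2 \<le> 1/x" "1/x \<le> -1" using assms by (auto simp: field_simps)
  then have "F (1/x) = 1/4 - 1/2 * J (-1 - 1/x)" using F_eq_J_m2_m1[of "1/x"] by (simp add: minus_diff_commute)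
  moreover have "F (-1-x) = 1/2 - 1/2 * J (x + 1)" using F_eq_J_mh_0[of "-1-x"] assms by (simp add: add.commute)
  ultimately show ?thesis using F_minus_1_half[of x] assms by simp
qed

lemma F_eq_J_1_2: "1 \<le> x \<Longrightarrow> x \<le> 2 \<Longrightarrow> F x = 7/8 + 1/4 * J (x-1)"
  using F_ge_1[of x] F_eq_J_m2_m1[of "-x"] by simp

lemma F_eq_J_ge_2: "2 \<le> x \<Longrightarrow> F x = 1 - 1/2 * J (1/x)"
  using F_ge_1[of x] F_eq_J_le_m2[of "-x"] by simp

text \<open>\<open>F_le_minus_1\<close> combined with \<open>F_ge_1\<close> shows that moving the
  argument one step to the left divides F by 4. This is the source of the powers of 4 in the
  interrobang recursion.\<close>

lemma F_minus_geometric: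
  assumes "1 \<le> s" "s \<le> 2" shows "F (- (s + real k)) = (1 - 2 * J (s - 1)) / 4 ^ Suc k"
proof (induction k)
  case 0
  then show ?case using F_eq_J_m2_m1[of "-s"] assms by (simp add: field_simps)
next
  case (Suc k)
  have "2 * F (- (s + real (Suc k))) = 1 - F (s + real k)"
    using F_le_minus_1[of "- (s + real (Suc k))"] assms by (simp add: algebra_simps)
  moreover have "2 * F (s + real k) = 2 - F (- (s + real k))"
    using F_ge_1[of "s + real k"] assms by simp
  ultimately have "4 * F (- (s + real (Suc k))) = F (- (s + real k))" by linarith
  with Suc show ?case by simp
qed

text \<open>Here J x = F (-1/x), and 1/x = s + (n - 1) with n the integer part of 1/x and s = 1 +
  frac (1/x) in [1, 2), so \<open>F_minus_geometric\<close> applies with n - 1 steps.\<close>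

lemma J_low:
  assumes "0 < x" "x \<le> 1/2"
  shows "J x = 4 powr (- real_of_int \<lfloor>1/x\<rfloor>) * (1 - 2 * J (frac (1/x)))"
proof -
  have 2: "1/x \<ge> 2" using assms by (simp add: field_simps)
  define n where "n = nat \<lfloor>1/x\<rfloor>"
  have "\<lfloor>1/x\<rfloor> \<ge> 2" using 2 by (simp add: le_floor_iff)
  then have n: "n \<ge> 2" "real_of_int \<lfloor>1/x\<rfloor> = real n" unfolding n_def by linarith+
  define s where "s = frac (1/x) + 1"
  have s: "1 \<le> s" "s \<le> 2" "1/x = s + real (n - 1)"
    using frac_ge_0[of "1/x"] frac_lt_1[of "1/x"] n by (auto simp: s_def frac_def of_nat_diff)
  have "J x = F (- (1/x))" using F_eq_J_le_m2[of "- (1/x)"] 2 by simp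
  also have "\<dots> = (1 - 2 * J (frac (1/x))) / 4 ^ Suc (n - 1)"
    using F_minus_geometric[OF s(1,2), of "n - 1"] unfolding s(3)[symmetric] by (simp add: s_def)
  also have "Suc (n - 1) = n" using n by simp
  finally show ?thesis unfolding n(2) by (simp add: powr_minus powr_realpow divide_inverse mult.commute)
qed

text \<open>In F x = 2 - F (1/x) - F (-x), the value J (1/x - 1) enters F (1/x) with weight 1/4 and
  F (-x) with weight 1/2; the constant is 2 - 7/8 - 1/4 - 1/2 = 3/8.\<close>

lemma J_high:
  assumes "1/2 < x" "x \<le> 1"
  shows "J x = 3/8 - 3/4 * J (1/x - 1) - 1/2 * J (1 - x)"
proof -
  have "1 \<le> 1/x" "1/x \<le> 2" using assms by (auto simp: field_simps)
  then show ?thesis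
    using F_0_1[of x] F_eq_J_1_2[of "1/x"] F_eq_J_m1_mh[of "-x"] assms by (simp add: J_def)
qed

section \<open>Identification with the interrobang function\<close>

lemma J_0: "J 0 = 0"
  by (simp add: J_def F_0)

text \<open>J solves the recursion, whose arguments stay rational and inside [0, 1];
  \<open>unit_rat_induct\<close> shows that no other function does.\<close>

lemma interrobang_rat_eq: "interrobang_rat = (\<lambda>x. if x \<in> \<rat> \<inter> {0..1} then J x else 0)"
  unfolding interrobang_rat_def
proof (rule the_equality)
  have "frac (1/x) \<in> \<rat> \<inter> {0..1}" if "x \<in> \<rat>" for x :: real
    using that frac_ge_0[of "1/x"] frac_lt_1[of "1/x"] by (auto simp: frac_def)
  moreover have "1/x - 1 \<in> \<rat> \<inter> {0..1}" "1 - x \<in> \<rat> \<inter> {0..1}" if "x \<in> \<rat>" "1/2 < x" "x \<le> 1" for x :: real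
    using that by (auto simp: field_simps)
  ultimately show "interrobang_eqns (\<lambda>x. if x \<in> \<rat> \<inter> {0..1} then J x else 0) \<and>
      (\<forall>x. x \<notin> \<rat> \<inter> {0..1} \<longrightarrow> (if x \<in> \<rat> \<inter> {0..1} then J x else 0) = 0)"
    unfolding interrobang_eqns_def using J_low J_high by (simp add: J_0)
next
  fix f assume f: "interrobang_eqns f \<and> (\<forall>x. x \<notin> \<rat> \<inter> {0..1} \<longrightarrow> f x = 0)"
  have "f x = J x" if "x \<in> \<rat>" "x \<in> {0..1}" for x
    using that
  proof (induction rule: unit_rat_induct)
    case zero
    then show ?case using f by (simp add: interrobang_eqns_def J_0)
  next
    case (low x)
    then show ?case using f J_low[of x] by (simp add: interrobang_eqns_def)
  next
    case (high x)
    then show ?case using f J_high[of x] by (simp add: interrobang_eqns_def)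
  qed
  with f show "f = (\<lambda>x. if x \<in> \<rat> \<inter> {0..1} then J x else 0)" by auto
qed

lemma J_continuous: "continuous_on A J"
  unfolding J_def by (intro continuous_intros continuous_on_subset[OF F_continuous]) auto

text \<open>The stationary law itself provides the continuous extension that the definite
  description presupposes. Density of the rationals in [0, 1] makes it unique.\<close>

lemma interrobang_eq: "interrobang = (\<lambda>x. if x \<in> {0..1} then J x else 0)"
  unfolding interrobang_def
proof (rule the_equality)
  have "continuous_on {0..1} (\<lambda>x. if x \<in> {0..1} then J x else 0)"
    using J_continuous[of "{0..1}"] by (rule continuous_on_eq) simp
  then show "continuous_on {0..1} (\<lambda>x. if x \<in> {0..1} then J x else 0) \<and>
     (\<forall>x\<in>\<rat> \<inter> {0..1}. (if x \<in> {0..1} then J x else 0) = interrobang_rat x) \<and>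
     (\<forall>x. x \<notin> {0..1} \<longrightarrow> (if x \<in> {0..1} then J x else 0) = 0)"
    by (auto simp: interrobang_rat_eq)
next
  fix g assume g: "continuous_on {0..1} g \<and> (\<forall>x\<in>\<rat> \<inter> {0..1}. g x = interrobang_rat x) \<and>
     (\<forall>x. x \<notin> {0..1} \<longrightarrow> g x = 0)"
  have cl: "closure (\<rat> \<inter> {0..1::real}) = {0..1}"
    using closure_convex_Int_superset[of "{0..1::real}" \<rat>]
    by (simp add: Rats_closure_real Int_commute)
  have "g x - J x = 0" if "x \<in> {0..1}" for x
    by (rule continuous_constant_on_closure[of "\<rat> \<inter> {0..1}" "\<lambda>x. g x - J x"])
      (use that g J_continuous[of "{0..1}"] in \<open>simp_all add: cl interrobang_rat_eq continuous_on_diff\<close>)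
  then have "g x = J x" if "x \<in> {0..1}" for x using that by force
  then show "g = (\<lambda>x. if x \<in> {0..1} then J x else 0)" using g by (intro ext) presburger
qed

lemma F_eq_interrobang:
  "(x \<le> -2 \<longrightarrow> F x = interrobang (-1/x)) \<and>
   (-2 \<le> x \<and> x \<le> -1 \<longrightarrow> F x = 1/4 - 1/2 * interrobang (-x-1)) \<and>
   (-1 \<le> x \<and> x \<le> -1/2 \<longrightarrow> F x = 1/4 + 1/2 * interrobang (-1 - 1/x) + 1/2 * interrobang (x+1)) \<and>
   (-1/2 \<le> x \<and> x \<le> 0 \<longrightarrow> F x = 1/2 - 1/2 * interrobang (-x)) \<and>
   (0 \<le> x \<and> x \<le> 1 \<longrightarrow> F x = 1/2 + interrobang x) \<and>
   (1 \<le> x \<and> x \<le> 2 \<longrightarrow> F x = 7/8 + 1/4 * interrobang (x-1)) \<and>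
   (2 \<le> x \<longrightarrow> F x = 1 - 1/2 * interrobang (1/x))"
proof (intro conjI impI; (elim conjE)?)
  assume "x \<le> -2"
  then have "-1/x \<in> {0..1}" by (auto simp: field_simps)
  with F_eq_J_le_m2[OF \<open>x \<le> -2\<close>] show "F x = interrobang (-1/x)" by (simp add: interrobang_eq)
next
  assume x: "-1 \<le> x" "x \<le> -1/2"
  then have "-1 - 1/x \<in> {0..1}" by (auto simp: field_simps)
  with F_eq_J_m1_mh[OF x] x show "F x = 1/4 + 1/2 * interrobang (-1 - 1/x) + 1/2 * interrobang (x+1)"
    by (simp add: interrobang_eq)
next
  assume "2 \<le> x"
  then have "1/x \<in> {0..1}" by (auto simp: field_simps)
  with F_eq_J_ge_2[OF \<open>2 \<le> x\<close>] show "F x = 1 - 1/2 * interrobang (1/x)" by (simp add: interrobang_eq)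
qed (simp_all add: interrobang_eq F_eq_J_m2_m1 F_eq_J_mh_0 F_eq_J_1_2, simp_all add: J_def)

section \<open>Arithmetic of the values of the distribution function\<close>

text \<open>A common reduction for both arithmetic claims: R is a class of arguments (rationals,
  quadratic irrationals) and P a class of values (dyadic, rational). The formulas for F use only J
  at arguments reached by the three moves, with dyadic coefficients.\<close>

lemma F_reduce_J:
  assumes "\<And>y. y \<in> {0..1} \<Longrightarrow> R y \<Longrightarrow> P (J y)"
    and R: "R x" "\<And>y. R y \<Longrightarrow> R (-y)" "\<And>y. R y \<Longrightarrow> R (y + 1)" "\<And>y. R y \<Longrightarrow> R (1/y)"
    and P: "P 1" "\<And>u v. P u \<Longrightarrow> P v \<Longrightarrow> P (u - v)" "\<And>u. P u \<Longrightarrow> P (u / 2)"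
  shows "P (F x)"
proof -
  have P0: "P 0" using P(1) P(2)[of 1 1] by simp
  have Padd: "P (u + v)" if "P u" "P v" for u v
    using P(2)[OF that(1) P(2)[OF P0 that(2)]] by simp
  have R': "R (-y-1)" "R (y - 1)" if "R y" for y
    using R(2)[OF R(3)[OF that]] R(2)[OF R(3)[OF R(2)[OF that]]] by simp_all
  have half: "P (1/2)" using P(3)[OF P(1)] .
  have quarter: "P (1/4)" using P(3)[OF half] by simp
  have eighth: "P (7/8)" using P(2)[OF P(1) P(3)[OF quarter]] by simp
  have *: "P (J y / 2)" "P (J y / 4)" "P (J y)" if "y \<in> {0..1}" "R y" for y
    using assms(1)[OF that] P(3)[of "J y"] P(3)[of "J y / 2"] by simp_all
  consider "x \<le> -2" | "-2 \<le> x" "x \<le> -1" | "-1 \<le> x" "x \<le> -1/2" | "-1/2 \<le> x" "x \<le> 0"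
    | "0 \<le> x" "x \<le> 1" | "1 \<le> x" "x \<le> 2" | "2 \<le> x" by linarith
  then show ?thesis
  proof cases
    case 1
    moreover have "R (-1/x)" using R(2)[OF R(4)[OF R(1)]] by simp
    moreover have "-1/x \<in> {0..1}" using 1 by (auto simp: field_simps)
    ultimately show ?thesis using F_eq_J_le_m2[of x] * by simp
  next
    case 2
    then show ?thesis using F_eq_J_m2_m1[of x] R'[OF R(1)] quarter by (auto intro!: * P(2))
  next
    case 3
    moreover have "-1 - 1/x \<in> {0..1}" using 3 by (auto simp: field_simps)
    moreover have "R (-1 - 1/x)" using R'(1)[OF R(4)[OF R(1)]] by (simp add: minus_diff_commute)
    ultimately show ?thesis using F_eq_J_m1_mh[of x] R(3)[OF R(1)] quarter by (auto intro!: * Padd)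
  next
    case 4
    then show ?thesis using F_eq_J_mh_0[of x] R(2)[OF R(1)] half by (auto intro!: * P(2))
  next
    case 5
    then show ?thesis using F_eq_J_0_1[of x] R(1) half by (auto intro!: * Padd)
  next
    case 6
    then show ?thesis using F_eq_J_1_2[of x] R'[OF R(1)] eighth by (auto intro!: * Padd)
  next
    case 7
    moreover have "1/x \<in> {0..1}" using 7 by (auto simp: field_simps)
    ultimately show ?thesis using F_eq_J_ge_2[of x] R(4)[OF R(1)] P(1) by (auto intro!: * P(2))
  qed
qed

lemma F_dyadic:
  assumes "x \<in> \<rat>" shows "dyadic (F x)"
proof (rule F_reduce_J[where R = "\<lambda>x. x \<in> \<rat>"])
  fix y :: real assume "y \<in> {0..1}" "y \<in> \<rat>"
  from this(2,1) show "dyadic (J y)"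
  proof (induction rule: unit_rat_induct)
    case zero
    then show ?case by (simp add: J_0)
  next
    case (low x)
    define n where "n = nat \<lfloor>1/x\<rfloor>"
    have "real_of_int \<lfloor>1/x\<rfloor> = real n" using low by (simp add: n_def)
    then have "4 powr (- real_of_int \<lfloor>1/x\<rfloor>) = (1/4 :: real) ^ n"
      by (simp add: powr_minus_divide powr_realpow power_one_over)
    then have "J x = (1/4) ^ n * (1 - 2 * J (frac (1/x)))" using J_low[of x] low by simp
    moreover have "dyadic ((1/4) ^ n * (1 - 2 * J (frac (1/x))))"
      using low by (intro dyadic_intros dyadic_numeral)
    ultimately show ?case by simp
  next
    case (high x)
    have "J x = 3/8 - 3/4 * J (1/x - 1) - 1/2 * J (1 - x)" using J_high high by blast
    moreover have "dyadic (3/8 - 3/4 * J (1/x - 1) - 1/2 * J (1 - x))"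
      using high by (intro dyadic_intros dyadic_numeral)
    ultimately show ?case by simp
  qed
qed (use assms in \<open>simp_all add: dyadic_intros\<close>)

text \<open>For x <= 1/2 this is \<open>J_low\<close>, with |B| = 2c <= 1/8. For x > 1/2 put y = 1/x
  - 1, the Gauss image of x. Then 1/(1 - x) = 1 + 1/y, so \<open>J_low\<close> at 1 - x leads to the
  Gauss image of y, and the coefficients sum to at most 3/4 + 1/16.\<close>

lemma J_gauss_recurrence:
  assumes "x \<notin> \<rat>" "x \<in> {0<..<1}"
  shows "\<exists>A\<in>\<rat>. \<exists>B\<in>\<rat>. \<exists>C\<in>\<rat>. \<bar>B\<bar> + \<bar>C\<bar> < 1 \<and> J x = A + B * J (gauss x) + C * J (gauss (gauss x))"
proof -
  have powr_bounds: "(4::real) powr (- real_of_int \<lfloor>t\<rfloor>) \<in> \<rat>"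
    "0 < (4::real) powr (- real_of_int \<lfloor>t\<rfloor>)"
    "(4::real) powr (- real_of_int \<lfloor>t\<rfloor>) \<le> 1/16" if "t \<ge> 2" for t :: real
  proof -
    define n where "n = nat \<lfloor>t\<rfloor>"
    have "\<lfloor>t\<rfloor> \<ge> 2" using that by (simp add: le_floor_iff)
    then have n: "n \<ge> 2" "real_of_int \<lfloor>t\<rfloor> = real n" unfolding n_def by linarith+
    have eq: "(4::real) powr (- real_of_int \<lfloor>t\<rfloor>) = 1 / 4 ^ n"
      unfolding n(2) by (simp add: powr_minus_divide powr_realpow)
    have "(4::real) ^ 2 \<le> 4 ^ n" using n by (intro power_increasing) auto
    then show "(4::real) powr (- real_of_int \<lfloor>t\<rfloor>) \<le> 1/16" unfolding eq by (simp add: field_simps)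
    show "(4::real) powr (- real_of_int \<lfloor>t\<rfloor>) \<in> \<rat>" unfolding eq by simp
  qed simp
  consider "x \<le> 1/2" | "1/2 < x" by linarith
  then show ?thesis
  proof cases
    case 1
    define c where "c = (4::real) powr (- real_of_int \<lfloor>1/x\<rfloor>)"
    have "1/x \<ge> 2" using 1 assms by (simp add: field_simps)
    note c = powr_bounds[OF this, folded c_def]
    have "J x = c + (- 2 * c) * J (gauss x) + 0 * J (gauss (gauss x))"
      using J_low[of x] 1 assms by (simp add: c_def gauss_def algebra_simps)
    moreover have "\<bar>- 2 * c\<bar> + \<bar>0\<bar> < 1" "- 2 * c \<in> \<rat>" using c by simp_all
    ultimately show ?thesis
      by (intro bexI[of _ c] bexI[of _ "- 2 * c"] bexI[of _ 0] conjI Rats_0 c)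
  next
    case 2
    define y where "y = 1/x - 1"
    have y: "0 < y" "y < 1" "1 - x = 1 / (1 + 1/y)" using assms 2 by (auto simp: y_def field_simps)
    have gx: "gauss x = y"
    proof -
      have "\<lfloor>1/x\<rfloor> = 1" using y by (intro floor_eq_iff[THEN iffD2]) (auto simp: y_def)
      then show ?thesis by (simp add: gauss_def frac_def y_def)
    qed
    define c where "c = (4::real) powr (- real_of_int \<lfloor>1 / (1 - x)\<rfloor>)"
    have "1 / (1 - x) \<ge> 2" using 2 assms by (simp add: field_simps)
    note c = powr_bounds[OF this, folded c_def]
    have "frac (1 / (1 - x)) = gauss y"
      unfolding y(3) gauss_def by (simp add: frac_def)
    then have "J (1 - x) = c * (1 - 2 * J (gauss (gauss x)))"
      using J_low[of "1 - x"] 2 assms unfolding gx c_def by simp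
    then have "J x = (3/8 - c/2) + (- 3/4) * J (gauss x) + c * J (gauss (gauss x))"
      using J_high[of x] 2 assms by (simp add: gx y_def algebra_simps)
    moreover have "\<bar>- 3/4\<bar> + \<bar>c\<bar> < 1" "3/8 - c/2 \<in> \<rat>" "- 3/4 \<in> \<rat>" using c by simp_all
    ultimately show ?thesis
      by (intro bexI[of _ "3/8 - c/2"] bexI[of _ "- 3/4"] bexI[of _ c] conjI c)
  qed
qed

lemma J_quadratic_irrational:
  assumes "y \<in> {0..1}" "quadratic_irrational y" shows "J y \<in> \<rat>"
proof -
  have irr: "y \<notin> \<rat>" using assms by (simp add: quadratic_irrational_def)
  then have "y \<noteq> 0" "y \<noteq> 1" by auto
  with assms have y: "y \<in> {0<..<1}" by auto
  obtain i j where ij: "i + 2 \<le> j" "(gauss ^^ i) y = (gauss ^^ j) y"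
    using quadratic_irrational_quad_root[OF assms(2)] gauss_orbit_periodic[OF irr y] by blast
  have "J ((gauss ^^ 0) y) \<in> \<rat>"
    using J_gauss_recurrence[OF gauss_iterate_irrational[OF irr y]] ij
    by (intro contracting_recurrence_rational[of "\<lambda>k. J ((gauss ^^ k) y)" i j]) simp_all
  then show ?thesis by simp
qed

lemma F_quadratic_irrational:
  assumes "quadratic_irrational x" shows "F x \<in> \<rat>"
proof (rule F_reduce_J[where R = quadratic_irrational])
  show "J y \<in> \<rat>" if "y \<in> {0..1}" "quadratic_irrational y" for y
    using that by (rule J_quadratic_irrational)
qed ((rule assms quadratic_irrational_uminus quadratic_irrational_add_1 quadratic_irrational_inverse
    Rats_1 Rats_diff; assumption) | simp)+

section \<open>Full support and strict monotonicity\<close>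

definition support_point :: "real \<Rightarrow> bool" where
  "support_point x \<longleftrightarrow> (\<forall>e>0. measure \<nu> (ball x e) > 0)"

lemma stationary_pos:
  assumes "B \<in> sets borel" "i \<in> {1, 2, 3}" "measure \<nu> (rfold i -` B) > 0"
  shows "measure \<nu> B > 0"
proof -
  have "measure \<nu> (rfold i -` B) \<le>
      measure \<nu> (rfold 1 -` B) + measure \<nu> (rfold 2 -` B) + measure \<nu> (rfold 3 -` B)"
    using assms(2) by auto
  with stationary[OF assms(1)] assms(3) show ?thesis by linarith
qed

lemma isCont_rfold: "isCont (rfold i) x"
proof -
  \<comment> \<open>This form has no case distinction, and its denominator is at least 1.\<close>
  have "rfold 2 = (\<lambda>x. x / max 1 (x\<^sup>2))"
  proof
    fix x :: real
    show "rfold 2 x = x / max 1 (x\<^sup>2)"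
      using abs_square_le_1[of x]
      by (auto simp: rfold_simps max_def power2_eq_square field_simps)
  qed
  moreover have "isCont (\<lambda>x. x / max 1 (x\<^sup>2)) (x::real)"
    by (intro continuous_intros) (auto simp: max_def)
  ultimately have 2: "isCont (rfold 2) x" by simp
  consider "i = 1" | "i = 2" | "i = 3" | "i \<notin> {1, 2, 3}" by blast
  then show ?thesis
    by cases (use 2 in \<open>auto simp: rfold_def[abs_def] intro!: continuous_intros\<close>)
qed

lemma support_point_rfold:
  assumes "support_point x" "i \<in> {1, 2, 3}" shows "support_point (rfold i x)"
  unfolding support_point_def
proof (intro allI impI)
  fix e :: real assume "e > 0"
  then obtain d where d: "d > 0" "\<forall>y. dist y x < d \<longrightarrow> dist (rfold i y) (rfold i x) < e"
    using isCont_rfold[where i = i and x = x] unfolding continuous_at_eps_delta by blast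
  have "0 < measure \<nu> (ball x d)" using assms(1) d unfolding support_point_def by blast
  also have "\<dots> \<le> measure \<nu> (rfold i -` ball (rfold i x) e)"
    using d by (intro finite_measure_mono) (auto simp: dist_commute)
  finally show "measure \<nu> (ball (rfold i x) e) > 0" 
    using stationary_pos[OF _ assms(2)] by simp
qed

text \<open>Fold 1 followed by fold 3 is translation by 1 on x >= -1/2, so every ray towards
  infinity has positive mass; fold 2 carries a remote ray into a small ball around 0.\<close>

lemma support_point_0: "support_point 0"
  unfolding support_point_def
proof (intro allI impI)
  fix e :: real assume "e > 0"
  \<comment> \<open>The margin 2 makes n - 1/2 exceed both 1/e and 1.\<close>
  then obtain n :: nat where n: "1 / e + 2 < real n" using reals_Archimedean2 by blast
  have pos: "measure \<nu> {real k - 1/2..} > 0" for k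
  proof (induction k)
    case 0
    have "rfold 1 -` (rfold 3 -` {-1/2..}) = UNIV"
    proof -
      have "-1/2 \<le> rfold 3 y" for y
        unfolding rfold_simps using abs_ge_zero[of y] by linarith
      then show ?thesis by auto
    qed
    then have "measure \<nu> (rfold 1 -` (rfold 3 -` {-1/2..})) > 0" by (simp only: measure_UNIV)
    then show ?case using stationary_pos[of "{-1/2..}" 3] stationary_pos[of "rfold 3 -` {-1/2..}" 1]
      by (auto)
  next
    case (Suc k)
    have "{real k - 1/2..} \<subseteq> rfold 1 -` (rfold 3 -` {real (Suc k) - 1/2..})"
      by (auto simp: rfold_simps min_def)
    then have "measure \<nu> (rfold 1 -` (rfold 3 -` {real (Suc k) - 1/2..})) > 0"
      using Suc by (intro less_le_trans[OF Suc] finite_measure_mono) (auto)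
    then show ?case
      using stationary_pos[of "{real (Suc k) - 1/2..}" 3]
        stationary_pos[of "rfold 3 -` {real (Suc k) - 1/2..}" 1]
      by (auto)
  qed
  have e1: "0 < 1/e" using \<open>e > 0\<close> by simp
  have "{real n - 1/2..} \<subseteq> rfold 2 -` ball 0 e"
  proof
    fix x assume "x \<in> {real n - 1/2..}"
    then have x: "x > 1/e" "x > 1" using n e1 unfolding atLeast_iff by linarith+
    then have "1/x < e" using \<open>e > 0\<close> by (simp add: field_simps)
    then show "x \<in> rfold 2 -` ball 0 e" using x by (simp add: rfold_simps)
  qed
  then have "measure \<nu> (rfold 2 -` ball 0 e) > 0"
    by (intro less_le_trans[OF pos[of n]] finite_measure_mono) (auto)
  then show "measure \<nu> (ball 0 e) > 0" using stationary_pos[of "ball 0 e" 2] by auto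
qed

text \<open>Euclid's algorithm run backwards from 0: on y >= 0 folds 1 and 3 give y + 1, and on |y|
  >= 1 fold 2 gives 1/y. Fold 1 then reaches y <= -1 from -1 - y, and fold 2 the interval (-1,
  0).\<close>

lemma support_point_rational:
  assumes "x \<in> \<rat>" shows "support_point x"
proof -
  have sp1: "support_point (min y (-1 - y))" if "support_point y" for y
    using support_point_rfold[OF that, of 1] by (simp add: rfold_simps)
  have sp2: "support_point (if \<bar>y\<bar> > 1 then 1 / y else y)" if "support_point y" for y
    using support_point_rfold[OF that, of 2] by (simp add: rfold_simps)
  have sp3: "support_point \<bar>y\<bar>" if "support_point y" for y
    using support_point_rfold[OF that, of 3] by (simp add: rfold_simps)
  have suc: "support_point (y + 1)" if "support_point y" "y \<ge> 0" for y
    using sp3[OF sp1[OF that(1)]] that(2) by (simp add: min_def add.commute)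
  have inv: "support_point (1/y)" if "support_point y" "\<bar>y\<bar> \<ge> 1" for y
    using sp2[OF that(1)] that(2) by (cases "\<bar>y\<bar> = 1") (auto simp: abs_if split: if_splits)
  have nonneg: "support_point (real a / real b)" if "b > 0" for a b :: nat
    using that
  proof (induction "a + b" arbitrary: a b rule: less_induct)
    case less
    consider "a = 0" | "b \<le> a" | "0 < a" "a < b" by linarith
    then show ?case
    proof cases
      case 1
      then show ?thesis by (simp add: support_point_0)
    next
      case 2
      have "support_point (real (a - b) / real b + 1)"
        by (rule suc, rule less.hyps) (use 2 less.prems in auto)
      then show ?thesis using 2 less.prems by (simp add: of_nat_diff field_simps)
    next
      case 3
      have "support_point (1 / (real (b - a) / real a + 1))"
        by (rule inv, rule suc, rule less.hyps) (use 3 less.prems in auto)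
      then show ?thesis using 3 less.prems by (simp add: of_nat_diff field_simps)
    qed
  qed
  have nonneg': "support_point y" if y: "y \<in> \<rat>" "y \<ge> 0" for y
  proof -
    obtain m n :: nat where "n \<noteq> 0" "\<bar>y\<bar> = real m / real n"
      using Rats_abs_nat_div_natE[OF y(1)] by metis
    with nonneg[of n m] y show ?thesis by simp
  qed
  have le: "support_point y" if "y \<in> \<rat>" "y \<le> -1" for y
    using sp1[OF nonneg'[of "-1 - y"]] that by (simp add: min_def)
  consider "x \<ge> 0" | "x \<le> -1" | "-1 < x" "x < 0" by linarith
  then show ?thesis
  proof cases
    case 3
    then have "1/x \<le> -1" by (simp add: field_simps)
    moreover from this have "\<bar>1/x\<bar> \<ge> 1" by linarith
    ultimately show ?thesis using inv[OF le[of "1/x"]] assms by simp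
  qed (use nonneg' le assms in auto)
qed

lemma F_strict_mono: "strict_mono F"
proof (rule strict_monoI)
  fix x y :: real assume "x < y"
  then obtain q where q: "q \<in> \<rat>" "x < q" "q < y" using Rats_dense_in_real by blast
  define e where "e = min (q - x) (y - q)"
  have "0 < measure \<nu> (ball q e)"
    using support_point_rational[OF q(1)] q unfolding support_point_def e_def by simp
  also have "\<dots> \<le> measure \<nu> {x..y}"
    by (intro finite_measure_mono) (auto simp: e_def dist_real_def)
  also have "\<dots> = F y - F x" using \<open>x < y\<close> by (simp add: measure_atLeastAtMost)
  finally show "F x < F y" by simp
qed

end

subsection \<open>The random walk\<close>

lemma cmod_mono_Re_Im: "\<bar>Re a\<bar> \<le> \<bar>Re b\<bar> \<Longrightarrow> \<bar>Im a\<bar> \<le> \<bar>Im b\<bar> \<Longrightarrow> cmod a \<le> cmod b"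
  unfolding cmod_def by (intro real_sqrt_le_mono add_mono) (simp_all add: abs_le_square_iff)

text \<open>The case of \<open>tau_lipschitz\<close> where one point is inverted and the other
  stays. With R = |z|^2 the difference of the squared distances is (1 - 1/R)(R + 1 - 2 <z, w>), and
  2 <z, w> <= 2 |z| <= R + 1.\<close>

lemma norm_inversion_diff_le:
  assumes "cmod z > 1" "cmod w \<le> 1" shows "cmod (1 / cnj z - w) \<le> cmod (z - w)"
proof (rule power2_le_imp_le)
  define R where "R = (cmod z)\<^sup>2"
  have R: "R > 1" using assms(1) by (simp add: R_def one_less_power)
  have inv: "1 / cnj z = z /\<^sub>R R"
  proof -
    have "z \<noteq> 0" using assms by auto
    then show ?thesis
      unfolding scaleR_conv_of_real R_def of_real_inverse complex_norm_square
      by (simp add: field_simps)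
  qed
  have "inner z w \<le> cmod z * 1"
    using norm_cauchy_schwarz[of z w] assms(2) by (meson mult_left_mono norm_ge_zero order_trans)
  moreover have "2 * cmod z \<le> R + 1"
    using zero_le_power2[of "cmod z - 1"] unfolding R_def by (simp add: power2_eq_square algebra_simps)
  ultimately have "0 \<le> (1 - 1/R) * (R + 1 - 2 * inner z w)"
    using R by (intro mult_nonneg_nonneg) auto
  also have "\<dots> = (cmod (z - w))\<^sup>2 - (cmod (z /\<^sub>R R - w))\<^sup>2"
    using R
    by (simp add: power2_norm_eq_inner inner_diff inner_commute R_def[unfolded power2_norm_eq_inner, symmetric])
      (simp add: field_simps)
  finally show "(cmod (1 / cnj z - w))\<^sup>2 \<le> (cmod (z - w))\<^sup>2" by (simp add: inv)
qed simp

section \<open>The folds of the plane\<close>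

locale walk_start =
  fixes z0 :: complex
  assumes z0: "- 1/2 < Re z0" "Re z0 < 0" "cmod z0 > 1"
begin

lemma tau_eq:
  "tau z0 (Suc 0) z = (if Re z > -1/2 then -1 - cnj z else z)"
  "tau z0 2 z = (if cmod z > 1 then 1 / cnj z else z)"
  "tau z0 3 z = (if Re z < 0 then - cnj z else z)"
  "i \<notin> {1, 2, 3} \<Longrightarrow> tau z0 i z = z"
  using z0 by (auto simp: tau_def same_side_def side_def refl_def zero_less_mult_iff)

lemma tau_of_real: "tau z0 i (of_real x) = of_real (rfold i x)"
proof -
  consider "i = 1" | "i = 2" | "i = 3" | "i \<notin> {1, 2, 3}" by blast
  then show ?thesis
  proof cases
    case 4
    then show ?thesis by (simp add: tau_eq rfold_def)
  qed (auto simp: tau_eq rfold_simps min_def)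
qed

text \<open>Folds 1 and 3 alter only the real part, by a fold of the line. For fold 2 with both
  points outside the unit disc, the distance is divided by |z| |w| > 1.\<close>

lemma tau_lipschitz: "cmod (tau z0 i z - tau z0 i w) \<le> cmod (z - w)"
proof -
  consider "i = 1" | "i = 2" | "i = 3" | "i \<notin> {1, 2, 3}" by blast
  then show ?thesis
  proof cases
    case 2
    consider "cmod z > 1" "cmod w > 1" | "cmod z > 1" "cmod w \<le> 1" | "cmod z \<le> 1" "cmod w > 1"
      | "cmod z \<le> 1" "cmod w \<le> 1" by linarith
    then show ?thesis
    proof cases
      case 1
      then have "z \<noteq> 0" "w \<noteq> 0" by auto
      then have "1 / cnj z - 1 / cnj w = cnj (w - z) / (cnj z * cnj w)" by (simp add: field_simps)
      then have "cmod (1 / cnj z - 1 / cnj w) = cmod (z - w) / (cmod z * cmod w)"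
        by (simp only: norm_divide norm_mult complex_mod_cnj norm_minus_commute)
      also have "\<dots> \<le> cmod (z - w) / 1"
        using 1 mult_mono[of 1 "cmod z" 1 "cmod w"] by (intro divide_left_mono) auto
      finally show ?thesis using 1 \<open>i = 2\<close> by (simp add: tau_eq)
    next
      case 2
      then show ?thesis using \<open>i = 2\<close> norm_inversion_diff_le[of z w] by (simp add: tau_eq)
    next
      case 3
      then show ?thesis using \<open>i = 2\<close> norm_inversion_diff_le[of w z]
        by (simp add: tau_eq norm_minus_commute)
    qed (use \<open>i = 2\<close> in \<open>simp add: tau_eq\<close>)
  qed (auto simp: tau_eq intro!: cmod_mono_Re_Im)
qed

lemma isCont_tau: "isCont (tau z0 i) z"
  unfolding continuous_at_eps_delta dist_norm using tau_lipschitz by (meson le_less_trans)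

text \<open>Later folds act first, so a prefix of the sequence stays outermost for all time. This is
  why a single contracting block controls every later position of the walk.\<close>

lemma walkmap_add:
  "walkmap z0 \<omega> (m + k) z = walkmap z0 \<omega> m (walkmap z0 (\<lambda>j. \<omega> (m + j)) k z)"
  by (induction k arbitrary: z) simp_all

lemma walk_case_nat: "walk z0 (case_nat i \<omega>) (Suc m) = tau z0 i (walk z0 \<omega> m)"
  using walkmap_add[of "case_nat i \<omega>" 1 m z0] by (simp add: walk_def)

lemma walkmap_lipschitz: "cmod (walkmap z0 \<omega> m z - walkmap z0 \<omega> m w) \<le> cmod (z - w)"
proof (induction m arbitrary: z w)
  case (Suc m)
  show ?case using order_trans[OF Suc tau_lipschitz] by simp
qed simp

lemma Im_walkmap_of_real: "Im (walkmap z0 \<omega> m (of_real x)) = 0"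
  by (induction m arbitrary: x) (simp_all add: tau_of_real)

section \<open>Contracting words and convergence of the walk\<close>

lemma Re_tau_3_1: "Re (tau z0 3 (tau z0 1 z)) \<ge> 1/2" "Re z \<ge> -1/2 \<Longrightarrow> Re (tau z0 3 (tau z0 1 z)) \<ge> Re z + 1"
  by (auto simp: tau_eq)

text \<open>The innermost pair of folds brings any point to real part at least 1/2; each of the n
  remaining pairs adds at least 1.\<close>

lemma Re_walkmap_alternating:
  assumes "\<forall>j<2 * Suc n. \<omega> j = (if even j then 3 else 1)"
  shows "Re (walkmap z0 \<omega> (2 * Suc n) z) \<ge> real n + 1/2"
proof -
  have *: "Re (walkmap z0 \<omega> (2 * k) z) \<ge> Re z + real k"
    if "Re z \<ge> -1/2" "\<forall>j<2 * k. \<omega> j = (if even j then 3 else 1)" for z k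
    using that
  proof (induction k arbitrary: z)
    case (Suc k)
    have "Re (tau z0 3 (tau z0 1 z)) \<ge> Re z + 1" using Re_tau_3_1(2) Suc.prems by blast
    moreover have "Re (walkmap z0 \<omega> (2 * k) (tau z0 3 (tau z0 1 z))) \<ge> Re (tau z0 3 (tau z0 1 z)) + real k"
      using Suc.prems calculation by (intro Suc.IH) auto
    ultimately show ?case using Suc.prems by simp
  qed simp
  have "Re (walkmap z0 \<omega> (2 * n) (tau z0 3 (tau z0 1 z))) \<ge> Re (tau z0 3 (tau z0 1 z)) + real n"
    using assms Re_tau_3_1(1)[of z] by (intro *) auto
  then show ?thesis using assms Re_tau_3_1(1)[of z] by simp
qed

text \<open>The word 2 3 1 3 1 ... 3 1 with n + 1 pairs, starting at position m. Its letter 2 acts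
  last and inverts a point whose real part is already at least n + 1/2.\<close>

definition contracting_at :: "nat \<Rightarrow> (nat \<Rightarrow> nat) \<Rightarrow> nat \<Rightarrow> bool" where
  "contracting_at n \<omega> m \<longleftrightarrow> \<omega> m = 2 \<and> (\<forall>j<2 * Suc n. \<omega> (Suc m + j) = (if even j then 3 else 1))"

text \<open>Past the end M of the block both maps factor through it, so the points reaching the
  outer part lie within 1/n of 0; the outer folds are 1-Lipschitz. The starting points are
  arbitrary, which permits comparison with a real one.\<close>

lemma walkmap_contracting:
  assumes "contracting_at n \<omega> m" "n > 0" "k \<ge> m + 1 + 2 * Suc n" "k' \<ge> m + 1 + 2 * Suc n"
  shows "cmod (walkmap z0 \<omega> k z - walkmap z0 \<omega> k' z') \<le> 2 / real n"
proof -
  define M where "M = m + 1 + 2 * Suc n"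
  have small: "cmod (tau z0 2 (walkmap z0 (\<lambda>j. \<omega> (Suc m + j)) (2 * Suc n) y)) \<le> 1 / real n" for y
  proof -
    let ?y = "walkmap z0 (\<lambda>j. \<omega> (Suc m + j)) (2 * Suc n) y"
    have "real n + 1/2 \<le> Re ?y"
      using assms(1) by (intro Re_walkmap_alternating) (simp add: contracting_at_def)
    then have "real n + 1/2 \<le> cmod ?y" using complex_Re_le_cmod[of ?y] by linarith
    then have "cmod ?y > 1" "real n \<le> cmod ?y" using \<open>n > 0\<close> by linarith+
    then show ?thesis using \<open>n > 0\<close> by (simp only: tau_eq) (simp add: norm_divide frac_le)
  qed
  have eq: "walkmap z0 \<omega> (M + l) y = walkmap z0 \<omega> m (tau z0 2 (walkmap z0 (\<lambda>j. \<omega> (Suc m + j))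
      (2 * Suc n) (walkmap z0 (\<lambda>j. \<omega> (M + j)) l y)))" for l y
    using assms(1) unfolding walkmap_add[of \<omega> M] unfolding M_def walkmap_add[of \<omega> "m + 1"]
    by (simp add: contracting_at_def)
  have "cmod (walkmap z0 \<omega> (M + l) y - walkmap z0 \<omega> (M + l') y') \<le> 2 / real n" for l l' y y'
    unfolding eq
    by (rule order_trans[OF walkmap_lipschitz], rule order_trans[OF norm_triangle_ineq4])
      (use add_mono[OF small small] in simp)
  moreover have "k = M + (k - M)" "k' = M + (k' - M)" using assms(3,4) by (auto simp: M_def)
  ultimately show ?thesis by metis
qed

definition contracting :: "(nat \<Rightarrow> nat) set" where
  "contracting = {\<omega>. \<forall>n. \<exists>m. contracting_at n \<omega> m}"

lemma walk_tendsto_real: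
  assumes "\<omega> \<in> contracting"
  shows "walk z0 \<omega> \<longlonglongrightarrow> of_real (zeta z0 \<omega>)"
proof -
  have close: "\<exists>N. \<forall>k\<ge>N. \<forall>k'\<ge>N. \<forall>z z'. cmod (walkmap z0 \<omega> k z - walkmap z0 \<omega> k' z') < e" if "e > 0" for e
  proof -
    obtain n where n: "2 / e < real n" using reals_Archimedean2 by blast
    moreover have "0 < 2 / e" using \<open>e > 0\<close> by simp
    ultimately have "real n > 0" by linarith
    with n \<open>e > 0\<close> have n': "n > 0" "2 / real n < e" by (auto simp: field_simps)
    obtain m where "contracting_at n \<omega> m" using assms unfolding contracting_def by blast
    then show ?thesis
      using walkmap_contracting[OF _ n'(1)] n'(2) by (meson le_less_trans)
  qed
  have "Cauchy (walk z0 \<omega>)"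
    unfolding Cauchy_def dist_norm walk_def using close by meson
  then obtain L where L: "walk z0 \<omega> \<longlonglongrightarrow> L" using Cauchy_convergent convergent_def by blast
  have "(\<lambda>m. Im (walk z0 \<omega> m)) \<longlonglongrightarrow> 0"
  proof (rule LIMSEQ_I)
    fix e :: real assume "e > 0"
    then obtain N where N: "\<forall>k\<ge>N. \<forall>k'\<ge>N. \<forall>z z'. cmod (walkmap z0 \<omega> k z - walkmap z0 \<omega> k' z') < e"
      using close by blast
    have "\<bar>Im (walk z0 \<omega> k)\<bar> < e" if "k \<ge> N" for k
    proof -
      \<comment> \<open>Comparison with the orbit of 0, which stays on the real line.\<close>
      have "\<bar>Im (walk z0 \<omega> k)\<bar> = \<bar>Im (walkmap z0 \<omega> k z0 - walkmap z0 \<omega> k (of_real 0))\<bar>"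
        unfolding minus_complex.sel Im_walkmap_of_real by (simp add: walk_def)
      also have "\<dots> \<le> cmod (walkmap z0 \<omega> k z0 - walkmap z0 \<omega> k (of_real 0))"
        by (rule abs_Im_le_cmod)
      also have "\<dots> < e" using N that by blast
      finally show ?thesis .
    qed
    then show "\<exists>N. \<forall>k\<ge>N. norm (Im (walk z0 \<omega> k) - 0) < e" by auto
  qed
  then have "Im L = 0" using tendsto_Im[OF L] LIMSEQ_unique by blast
  moreover have "zeta z0 \<omega> = Re L" using limI[OF L] by (simp add: zeta_def)
  ultimately have "of_real (zeta z0 \<omega>) = L" by (simp add: complex_eq_iff)
  with L show ?thesis by simp
qed

lemma contracting_at_case_nat: "contracting_at n \<omega> m \<Longrightarrow> contracting_at n (case_nat i \<omega>) (Suc m)"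
  by (simp add: contracting_at_def)

lemma contracting_case_nat: "\<omega> \<in> contracting \<Longrightarrow> case_nat i \<omega> \<in> contracting"
  unfolding contracting_def using contracting_at_case_nat by blast

text \<open>A prepended letter acts as one outermost fold, and by continuity this fold passes to the
  limit.\<close>

lemma zeta_case_nat:
  assumes "\<omega> \<in> contracting" shows "zeta z0 (case_nat i \<omega>) = rfold i (zeta z0 \<omega>)"
proof -
  have "(\<lambda>m. tau z0 i (walk z0 \<omega> m)) \<longlonglongrightarrow> tau z0 i (of_real (zeta z0 \<omega>))"
    using isCont_tendsto_compose[OF isCont_tau walk_tendsto_real[OF assms]] .
  then have "(\<lambda>m. walk z0 (case_nat i \<omega>) (Suc m)) \<longlonglongrightarrow> of_real (rfold i (zeta z0 \<omega>))"
    by (simp only: walk_case_nat tau_of_real)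
  moreover have "(\<lambda>m. walk z0 (case_nat i \<omega>) (Suc m)) \<longlonglongrightarrow> of_real (zeta z0 (case_nat i \<omega>))"
    using walk_tendsto_real[OF contracting_case_nat[OF assms]] by (rule LIMSEQ_Suc)
  ultimately show ?thesis using LIMSEQ_unique of_real_eq_iff by blast
qed

end

section \<open>The space of index sequences\<close>

lemma space_walk_space [simp]: "space walk_space = UNIV"
  by (simp add: walk_space_def space_PiM)

lemma prob_space_walk_space: "prob_space walk_space"
  unfolding walk_space_def by (intro prob_space_PiM measure_pmf.prob_space_axioms)

lemma walk_space_component [measurable]: "(\<lambda>\<omega>. \<omega> k) \<in> walk_space \<rightarrow>\<^sub>M count_space UNIV"
proof -
  have "(\<lambda>\<omega>. \<omega> k) \<in> walk_space \<rightarrow>\<^sub>M measure_pmf (pmf_of_set {1,2,3::nat})"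
    unfolding walk_space_def by measurable
  then show ?thesis by simp
qed

lemma case_nat_walk_space [measurable]: "case_nat i \<in> walk_space \<rightarrow>\<^sub>M walk_space"
proof -
  have "(\<lambda>\<omega>. case_nat i \<omega>) \<in> walk_space \<rightarrow>\<^sub>M walk_space"
    unfolding walk_space_def by (intro measurable_case_nat') auto
  then show ?thesis by simp
qed

text \<open>Conditioning on the first letter: by \<open>PiM_iter\<close> the sequence space is the
  image of one letter times the sequence space.\<close>

lemma measure_walk_space_first_step:
  assumes [measurable]: "A \<in> sets walk_space"
  shows "3 * measure walk_space A = (\<Sum>i\<in>{1,2,3}. measure walk_space (case_nat i -` A))"
proof -
  let ?M = "measure_pmf (pmf_of_set {1,2,3::nat})"
  interpret W: prob_space walk_space by (rule prob_space_walk_space)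
  interpret sequence_space ?M by unfold_locales
  have f [measurable]: "(\<lambda>(s, \<omega>). case_nat s \<omega>) \<in> (?M \<Otimes>\<^sub>M walk_space) \<rightarrow>\<^sub>M walk_space"
    unfolding walk_space_def by measurable
  have "emeasure walk_space A = emeasure (distr (?M \<Otimes>\<^sub>M walk_space) walk_space (\<lambda>(s, \<omega>). case_nat s \<omega>)) A"
    by (simp only: walk_space_def PiM_iter)
  also have "\<dots> = emeasure (?M \<Otimes>\<^sub>M walk_space)
      ((\<lambda>(s, \<omega>). case_nat s \<omega>) -` A \<inter> space (?M \<Otimes>\<^sub>M walk_space))"
    by (rule emeasure_distr) measurable
  also have "\<dots> = (\<integral>\<^sup>+ s. emeasure walk_space (case_nat s -` A) \<partial>?M)"
    by (subst W.emeasure_pair_measure_alt[OF measurable_sets[OF f assms]])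
      (auto simp: space_pair_measure vimage_def)
  also have "\<dots> = (\<Sum>i\<in>{1,2,3}. emeasure walk_space (case_nat i -` A)) / 3"
    by (subst nn_integral_pmf_of_set) auto
  finally have "ennreal (measure walk_space A) = ennreal ((\<Sum>i\<in>{1,2,3}. measure walk_space (case_nat i -` A)) / 3)"
    by (simp add: W.emeasure_eq_measure ennreal_plus[symmetric] divide_ennreal[symmetric]
        del: ennreal_plus)
  then show ?thesis by (subst (asm) ennreal_inj) (auto intro!: sum_nonneg add_nonneg_nonneg)
qed

lemma case_nat_vimage_sets [simp]: "A \<in> sets walk_space \<Longrightarrow> case_nat i -` A \<in> sets walk_space"
  using measurable_sets[OF case_nat_walk_space, of A i] by simp

text \<open>No cylinder section of A is larger than A, but their average is the measure of A; so all of
  them, including the empty one given by w, have the measure of A.\<close>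

lemma prefix_avoiding_null:
  assumes A: "A \<in> sets walk_space" and drop: "\<And>i \<omega>. case_nat i \<omega> \<in> A \<Longrightarrow> \<omega> \<in> A"
    and w: "set w \<subseteq> {1,2,3}" "\<And>\<omega>. foldr case_nat w \<omega> \<notin> A"
  shows "measure walk_space A = 0"
proof -
  interpret prob_space walk_space by (rule prob_space_walk_space)
  have "foldr case_nat v -` A \<in> sets walk_space \<and> foldr case_nat v -` A \<subseteq> A
      \<and> (set v \<subseteq> {1,2,3} \<longrightarrow> measure walk_space (foldr case_nat v -` A) = measure walk_space A)" for v
  proof (induction v rule: rev_induct)
    case Nil
    then show ?case using A by (simp add: id_def)
  next
    case (snoc i v)
    let ?B = "foldr case_nat v -` A"
    have eq: "foldr case_nat (v @ [j]) -` A = case_nat j -` ?B" for j by auto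
    have sub: "case_nat j -` ?B \<subseteq> A" for j using snoc drop by blast
    have le: "measure walk_space (case_nat j -` ?B) \<le> measure walk_space A" for j
      using sub A by (rule finite_measure_mono)
    have "measure walk_space (case_nat i -` ?B) = measure walk_space A" if "set (v @ [i]) \<subseteq> {1,2,3}"
    proof -
      have "3 * measure walk_space A = (\<Sum>i\<in>{1,2,3}. measure walk_space (case_nat i -` ?B))"
        using measure_walk_space_first_step[of ?B] snoc that by simp
      then show ?thesis using le[of 1] le[of 2] le[of 3] that by auto
    qed
    with sub snoc show ?case unfolding eq by simp
  qed
  then have "measure walk_space (foldr case_nat w -` A) = measure walk_space A" using w(1) by blast
  moreover have "foldr case_nat w -` A = {}" using w(2) by auto
  ultimately show ?thesis by simp
qed

lemma foldr_case_nat_nth: "k < length w \<Longrightarrow> foldr case_nat w \<omega> k = w ! k"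
  by (induction w arbitrary: k) (auto simp: nth_Cons split: nat.split)

section \<open>The law of the limit\<close>

context walk_start begin

text \<open>For fixed n, the sequences without a block keep this property when their first letter is
  dropped, and no sequence that begins with the block is among them, so
  \<open>prefix_avoiding_null\<close> applies.\<close>

lemma AE_contracting: "AE \<omega> in walk_space. \<omega> \<in> contracting"
proof -
  interpret prob_space walk_space by (rule prob_space_walk_space)
  have "AE \<omega> in walk_space. \<exists>m. contracting_at n \<omega> m" for n
  proof -
    define A where "A = {\<omega>. \<nexists>m. contracting_at n \<omega> m}"
    have "{\<omega> \<in> space walk_space. \<nexists>m. contracting_at n \<omega> m} \<in> sets walk_space"
      unfolding contracting_at_def by measurable
    then have A: "A \<in> sets walk_space" by (simp add: A_def)
    let ?w = "2 # map (\<lambda>j. if even j then 3 else 1) [0..<2 * Suc n]"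
    have "contracting_at n (foldr case_nat ?w \<omega>) 0" for \<omega>
      unfolding contracting_at_def
    proof (intro conjI allI impI)
      fix j assume j: "j < 2 * Suc n"
      have "foldr case_nat ?w \<omega> (Suc 0 + j) = ?w ! (Suc 0 + j)"
        using j by (intro foldr_case_nat_nth) simp
      also have "\<dots> = (if even j then 3 else 1)" using j by (simp del: upt_Suc)
      finally show "foldr case_nat ?w \<omega> (Suc 0 + j) = (if even j then 3 else 1)" .
    qed simp
    then have "measure walk_space A = 0"
    proof (intro prefix_avoiding_null[of A ?w] A)
      show "\<omega> \<in> A" if "case_nat i \<omega> \<in> A" for i \<omega>
        using that contracting_at_case_nat unfolding A_def by blast
    qed (auto simp: A_def simp del: upt_Suc foldr.simps)
    then show ?thesis
      using A by (intro AE_I[of _ _ A]) (auto simp: A_def emeasure_eq_measure)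
  qed
  then show ?thesis unfolding contracting_def by (simp add: AE_all_countable)
qed

lemma walk_measurable [measurable]: "(\<lambda>\<omega>. walk z0 \<omega> m) \<in> borel_measurable walk_space"
proof -
  have "(\<lambda>\<omega>. walkmap z0 \<omega> m z) \<in> borel_measurable walk_space" for z
  proof (induction m arbitrary: z)
    case (Suc m)
    \<comment> \<open>The last letter takes countably many values, and for each of them the
      induction hypothesis applies to the fixed start \<open>tau z0 i z\<close>.\<close>
    have "(\<lambda>\<omega>. walkmap z0 \<omega> m (tau z0 (\<omega> m) z)) \<in> borel_measurable walk_space"
      by (rule measurable_compose_countable[where f = "\<lambda>i \<omega>. walkmap z0 \<omega> m (tau z0 i z)"])
        (use Suc in auto)
    then show ?case by simp
  qed simp
  then show ?thesis by (simp add: walk_def)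
qed

lemma zeta_measurable [measurable]: "zeta z0 \<in> borel_measurable walk_space"
  unfolding zeta_def[abs_def] by measurable

lemma fold_stationary_zeta: "fold_stationary (distr walk_space borel (zeta z0))"
proof -
  interpret prob_space walk_space by (rule prob_space_walk_space)
  interpret D: prob_space "distr walk_space borel (zeta z0)"
    by (rule prob_space_distr) measurable
  show ?thesis
  proof
    fix B :: "real set" assume B[measurable]: "B \<in> sets borel"
    have vim: "zeta z0 -` C \<in> sets walk_space" if "C \<in> sets borel" for C
      using measurable_sets[OF zeta_measurable that] by simp
    have m: "measure (distr walk_space borel (zeta z0)) C = measure walk_space (zeta z0 -` C)"
      if "C \<in> sets borel" for C
      using measure_distr[OF zeta_measurable that] by simp
    \<comment> \<open>The two sets agree only on \<open>contracting\<close>, hence up to a null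
      set.\<close>
    have "measure walk_space (case_nat i -` (zeta z0 -` B)) = measure walk_space (zeta z0 -` (rfold i -` B))" for i
      by (rule measure_eq_AE) (use AE_contracting in \<open>auto simp: zeta_case_nat vim B elim!: AE_mp\<close>)
    then show "3 * measure (distr walk_space borel (zeta z0)) B =
        measure (distr walk_space borel (zeta z0)) (rfold 1 -` B) +
        measure (distr walk_space borel (zeta z0)) (rfold 2 -` B) +
        measure (distr walk_space borel (zeta z0)) (rfold 3 -` B)"
      using measure_walk_space_first_step[OF vim[OF B]] by (simp add: m B)
  qed simp_all
qed

lemma F_zeta_eq_cdf: "F_zeta z0 = cdf (distr walk_space borel (zeta z0))"
  by (auto simp: F_zeta_def cdf_def measure_distr vimage_def)

end

theorem mainTheorem16:
  fixes z0 :: complex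
  assumes "Im z0 > 0" and "- 1/2 < Re z0" and "Re z0 < 0" and "cmod z0 > 1"
  shows "(AE \<omega> in walk_space. \<exists>\<zeta>::real. (\<lambda>m. walk z0 \<omega> m) \<longlonglongrightarrow> complex_of_real \<zeta>)
    \<and> zeta z0 \<in> borel_measurable walk_space
    \<and> (\<forall>x::real.
         (x \<le> -2 \<longrightarrow> F_zeta z0 x = interrobang (-1/x)) \<and>
         (-2 \<le> x \<and> x \<le> -1 \<longrightarrow> F_zeta z0 x = 1/4 - 1/2 * interrobang (-x-1)) \<and>
         (-1 \<le> x \<and> x \<le> -1/2 \<longrightarrow>
            F_zeta z0 x = 1/4 + 1/2 * interrobang (-1 - 1/x) + 1/2 * interrobang (x+1)) \<and>
         (-1/2 \<le> x \<and> x \<le> 0 \<longrightarrow> F_zeta z0 x = 1/2 - 1/2 * interrobang (-x)) \<and>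
         (0 \<le> x \<and> x \<le> 1 \<longrightarrow> F_zeta z0 x = 1/2 + interrobang x) \<and>
         (1 \<le> x \<and> x \<le> 2 \<longrightarrow> F_zeta z0 x = 7/8 + 1/4 * interrobang (x-1)) \<and>
         (2 \<le> x \<longrightarrow> F_zeta z0 x = 1 - 1/2 * interrobang (1/x)))
    \<and> continuous_on UNIV (F_zeta z0)
    \<and> strict_mono (F_zeta z0)
    \<and> (\<forall>x\<in>\<rat>. dyadic (F_zeta z0 x))
    \<and> (\<forall>x. quadratic_irrational x \<longrightarrow> F_zeta z0 x \<in> \<rat>)"
proof -
  interpret walk_start z0 using assms by unfold_locales
  interpret fold_stationary "distr walk_space borel (zeta z0)" by (rule fold_stationary_zeta)
  have "AE \<omega> in walk_space. \<exists>\<zeta>::real. (\<lambda>m. walk z0 \<omega> m) \<longlonglongrightarrow> complex_of_real \<zeta>"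
    using AE_contracting by (rule AE_mp) (auto intro!: AE_I2 intro: walk_tendsto_real)
  then show ?thesis
    unfolding F_zeta_eq_cdf
    using F_eq_interrobang F_continuous F_strict_mono F_dyadic F_quadratic_irrational
    by (intro conjI zeta_measurable) blast+
qed

end
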